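(* Let $q>1$ be a real number and let $\alpha_1=\lceil q\rceil-1$. The following statements are equivalent. (i) $q\in(1,\infty)\setminus\overline{\mathcal U}$. (ii) $\mathcal U_q'$ is a subshift of finite type. (iii) $\mathcal U_q'$ is a subshift. (iv) $\mathcal U_q'$ is a closed subset of $\{0,\dots,\alpha_1\}^{\mathbb N}$.
   Context: Let $\mathbb N=\{1,2,\dots\}$. For a real $q>1$, $\lceil q\rceil$ is the smallest integer $\ge q$. An expansion of a real number $x$ in base $q$ is a sequence $(c_i)_{i\ge1}$ of integers with $0\le c_i<q$ for all $i\ge1$ (equivalently $c_i\in\{0,\dots,\alpha_1\}$ with $\alpha_1=\lceil q\rceil-1$) and $x=\sum_{i\ge1}c_iq^{-i}$. $\mathcal U$ is the set of real numbers $q>1$ for which $1$ has exactly one expansion in base $q$, and $\overline{\mathcal U}$ is its topological closure. For $q>1$, $\mathcal U_q$ is the set of real numbers $x$ having exactly one expansion in base $q$, and $\mathcal U_q'\subset\{0,\dots,\alpha_1\}^{\mathbb N}$ is the set of these unique expansions of the elements $x\in\mathcal U_q$. A set $S\subset\{0,\dots,\alpha_1\}^{\mathbb N}$ is called a subshift if there exists a set $\mathcal F(S)\subset\bigcup_{k=1}^\infty\{0,\dots,\alpha_1\}^k$ such that a sequence $(c_i)\in\{0,\dots,\alpha_1\}^{\mathbb N}$ belongs to $S$ if and only if none of the blocks $c_{i+1}\ldots c_{i+n}$ ($i\ge0$, $n\ge1$) belongs to $\mathcal F(S)$. A subshift $S$ is a subshift of finite type if $\mathcal F(S)$ can be chosen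 finite. The set $\{0,\dots,\alpha_1\}^{\mathbb N}$ carries the topology of coordinate-wise convergence. *)

theory Defs
  imports "HOL-Analysis.Analysis"
begin

text \<open>
  Sequences are indexed from 0: the value \<open>c i\<close> stands for the mathematical $c_{i+1}$.
  Digits are natural numbers, so the lower bound on digits is implicit.
\<close>

definition is_expansion :: "real \<Rightarrow> real \<Rightarrow> (nat \<Rightarrow> nat) \<Rightarrow> bool" where
  "is_expansion q x c \<longleftrightarrow>
     (\<forall>i. real (c i) < q) \<and> (\<lambda>i. real (c i) / q ^ Suc i) sums x"

definition univoque_bases :: "real set" where
  "univoque_bases = {q. q > 1 \<and> (\<exists>!c. is_expansion q 1 c)}"

definition univoque_set :: "real \<Rightarrow> real set" where
  "univoque_set q = {x. \<exists>!c. is_expansion q x c}"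

definition univoque_seqs :: "real \<Rightarrow> (nat \<Rightarrow> nat) set" where
  "univoque_seqs q = {c. \<exists>x\<in>univoque_set q. is_expansion q x c}"

definition max_digit :: "real \<Rightarrow> nat" where
  "max_digit q = nat (\<lceil>q\<rceil> - 1)"

definition digit_seqs :: "nat \<Rightarrow> (nat \<Rightarrow> nat) set" where
  "digit_seqs m = {c. \<forall>i. c i \<in> {0..m}}"

text \<open>The topology of coordinate-wise convergence; its underlying space is \<open>digit_seqs m\<close>.\<close>

definition digit_topology :: "nat \<Rightarrow> (nat \<Rightarrow> nat) topology" where
  "digit_topology m = product_topology (\<lambda>_. discrete_topology {0..m}) UNIV"

lemma topspace_digit_topology: "topspace (digit_topology m) = digit_seqs m"
  by (auto simp: digit_topology_def digit_seqs_def PiE_def)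

definition digit_blocks :: "nat \<Rightarrow> nat list set" where
  "digit_blocks m = {w. w \<noteq> [] \<and> set w \<subseteq> {0..m}}"

definition block :: "(nat \<Rightarrow> nat) \<Rightarrow> nat \<Rightarrow> nat \<Rightarrow> nat list" where
  "block c i n = map c [i..<i + n]"

definition forbidden_blocks_for :: "nat \<Rightarrow> (nat \<Rightarrow> nat) set \<Rightarrow> nat list set \<Rightarrow> bool" where
  "forbidden_blocks_for m S F \<longleftrightarrow>
     F \<subseteq> digit_blocks m \<and>
     (\<forall>c\<in>digit_seqs m. c \<in> S \<longleftrightarrow> (\<forall>i n. n \<ge> 1 \<longrightarrow> block c i n \<notin> F))"

definition subshift :: "nat \<Rightarrow> (nat \<Rightarrow> nat) set \<Rightarrow> bool" where
  "subshift m S \<longleftrightarrow> S \<subseteq> digit_seqs m \<and> (\<exists>F. forbidden_blocks_for m S F)"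

definition subshift_finite_type :: "nat \<Rightarrow> (nat \<Rightarrow> nat) set \<Rightarrow> bool" where
  "subshift_finite_type m S \<longleftrightarrow>
     S \<subseteq> digit_seqs m \<and> (\<exists>F. finite F \<and> forbidden_blocks_for m S F)"

end

theory Submission
  imports Defs
begin

text \<open>
  Let $M = \lceil q\rceil - 1$ and let $\alpha$ be the quasi-greedy expansion of $1$ in base $q$, that
  is, the expansion all of whose tails have value in $(0,1]$. Write $\sigma^n c$ for the $n$-th tail of
  a sequence $c$ and $\overline{c}$ for its reflection, the digitwise difference to the maximal digit;
  order sequences lexicographically. A value comparison shows that a sequence $c$ with digits at most
  $M$ is a unique expansion in base $q$ if and only if the tail after every digit below $M$ is smaller
  than $\alpha$ and the reflected tail after every positive digit is smaller than $\alpha$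
  (\<open>univoque_seqs_lex_iff\<close>).

  Everything hinges on the condition that $\overline{\sigma^n\alpha} < \alpha$ for all $n \ge 1$
  (\<open>reflection_dominated\<close>).

  \<^item> If it fails for $n = k$, every comparison with $\alpha$ in the characterization of unique
    expansions is decided within $k$ digits: if a tail of a unique expansion agreed with $\alpha$ on
    $k$ digits, the rest $d$ of that tail would satisfy $d < \sigma^k\alpha$, hence
    $\overline{d} > \overline{\sigma^k\alpha} \ge \alpha$, contradicting uniqueness. So forbidding
    finitely many blocks of length $k+1$ describes the unique expansions
    (\<open>subshift_finite_type_if_not_dominated\<close>).

  \<^item> If it holds, arbitrarily long prefixes $u = \alpha_1 \ldots \alpha_m$ inherit it: each comparison
    of a reflected proper suffix of $u$ with $\alpha$ is decided inside $u$
    (\<open>dominating_prefix_unbounded\<close>). Let $w$ be the periodic repetition of $u$ with its last digit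
    lowered by one. All tails of $w$ and of $\overline{w}$ are below $\alpha$, so $0w$ is a unique
    expansion; as $m$ grows, $0w$ tends to $0\alpha$, which is not one. Hence the set of unique
    expansions is not closed (\<open>not_closedin_if_reflection_dominated\<close>).

  \<^item> The condition is equivalent to $q \in \overline{\mathcal U}$. If it holds, the sequence
    $v = u\,\overline{w}$ is the unique expansion of $1$ in some base, and this base tends to $q$ as
    $m$ grows (\<open>closure_if_reflection_dominated\<close>). Conversely, let bases $q_n \in \mathcal U$ tend to
    $q$. Their expansions of $1$ satisfy the condition, and a subsequence converges digitwise to an
    expansion $c$ of $1$ in base $q$. A finite $c$ is impossible, so $c = \alpha$, and the condition
    passes to the limit; equality $\overline{\sigma^k c} = c$ is excluded because it makes $c$ periodic,
    and then no other sequence that dominates its tails and satisfies the condition is close to $c$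
    (\<open>reflection_dominated_if_closure\<close>).
\<close>

section \<open>Tails, reflections and the lexicographic order\<close>

text \<open>
  The sequence without its first $n$ digits. Since indices start at 0, the tail that follows the digit
  \<open>c n\<close> is \<open>tail (Suc n) c\<close>.
\<close>

definition tail :: "nat \<Rightarrow> (nat \<Rightarrow> nat) \<Rightarrow> nat \<Rightarrow> nat" where
  "tail n c = (\<lambda>i. c (n + i))"

text \<open>
  The sequence of the digits $M - c_i$. The subtraction truncates, so it is an involution only on
  sequences with digits at most $M$.
\<close>

definition reflection :: "nat \<Rightarrow> (nat \<Rightarrow> nat) \<Rightarrow> nat \<Rightarrow> nat" where
  "reflection M c = (\<lambda>i. M - c i)"

text \<open>
  The strict lexicographic comparison of \<open>c\<close> with \<open>d\<close> is decided among the first $N$ digits.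
\<close>

definition lex_below :: "nat \<Rightarrow> (nat \<Rightarrow> nat) \<Rightarrow> (nat \<Rightarrow> nat) \<Rightarrow> bool" where
  "lex_below N c d \<longleftrightarrow> (\<exists>j<N. (\<forall>i<j. c i = d i) \<and> c j < d j)"

text \<open>
  The strict lexicographic order.
\<close>

definition lex_less :: "(nat \<Rightarrow> nat) \<Rightarrow> (nat \<Rightarrow> nat) \<Rightarrow> bool" where
  "lex_less c d \<longleftrightarrow> (\<exists>j. (\<forall>i<j. c i = d i) \<and> c j < d j)"

lemma tail_apply [simp]: "tail n c i = c (n + i)"
  by (simp add: tail_def)

lemma reflection_apply [simp]: "reflection M c i = M - c i"
  by (simp add: reflection_def)

lemma tail_0 [simp]: "tail 0 c = c"
  by (simp add: tail_def)

lemma tail_tail [simp]: "tail m (tail n c) = tail (n + m) c"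
  by (simp add: tail_def add.assoc)

lemma tail_reflection: "tail n (reflection M c) = reflection M (tail n c)"
  by (simp add: tail_def reflection_def)

lemma reflection_reflection:
  assumes "\<forall>i. c i \<le> M"
  shows "reflection M (reflection M c) = c"
  using assms by (auto simp: reflection_def)

lemma lex_belowI: "j < N \<Longrightarrow> (\<And>i. i < j \<Longrightarrow> c i = d i) \<Longrightarrow> c j < d j \<Longrightarrow> lex_below N c d"
  unfolding lex_below_def by blast

lemma lex_lessI: "(\<And>i. i < j \<Longrightarrow> c i = d i) \<Longrightarrow> c j < d j \<Longrightarrow> lex_less c d"
  unfolding lex_less_def by blast

lemma lex_lessE:
  assumes "lex_less c d"
  obtains j where "\<forall>i<j. c i = d i" "c j < d j"
  using assms unfolding lex_less_def by blast

lemma lex_below_imp_less: "lex_below N c d \<Longrightarrow> lex_less c d"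
  unfolding lex_below_def lex_less_def by blast

lemma lex_below_cong:
  assumes "lex_below N c d" "\<And>i. i < N \<Longrightarrow> c i = c' i" "\<And>i. i < N \<Longrightarrow> d i = d' i"
  shows "lex_below N c' d'"
proof -
  obtain j where j: "j < N" "\<forall>i<j. c i = d i" "c j < d j"
    using assms(1) unfolding lex_below_def by blast
  have "\<forall>i<j. c' i = d' i"
    using j(1,2) assms(2,3) by (metis order.strict_trans)
  moreover have "c' j < d' j"
    using j assms(2,3) by metis
  ultimately show ?thesis
    using j(1) unfolding lex_below_def by blast
qed

lemma lex_irrefl: "\<not> lex_less c c"
  unfolding lex_less_def by blast

lemma lex_trans:
  assumes "lex_less c d" "lex_less d e"
  shows "lex_less c e"
proof -
  obtain j where j: "\<forall>i<j. c i = d i" "c j < d j" using assms(1) by (rule lex_lessE)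
  obtain k where k: "\<forall>i<k. d i = e i" "d k < e k" using assms(2) by (rule lex_lessE)
  show ?thesis
  proof (rule lex_lessI)
    show "c i = e i" if "i < min j k" for i
      using that j(1) k(1) by simp
    show "c (min j k) < e (min j k)"
      using j k by (cases j k rule: linorder_cases) auto
  qed
qed

lemma lex_asym: "lex_less c d \<Longrightarrow> \<not> lex_less d c"
  by (metis lex_irrefl lex_trans)

lemma first_difference:
  assumes "c \<noteq> (d :: nat \<Rightarrow> nat)"
  obtains j where "\<forall>i<j. c i = d i" "c j \<noteq> d j"
proof -
  obtain j0 where "c j0 \<noteq> d j0" using assms by auto
  then have "c (LEAST j. c j \<noteq> d j) \<noteq> d (LEAST j. c j \<noteq> d j)"
    by (rule LeastI)
  moreover have "\<forall>i<(LEAST j. c j \<noteq> d j). c i = d i"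
    using not_less_Least by blast
  ultimately show ?thesis using that by blast
qed

lemma lex_total: "c \<noteq> d \<Longrightarrow> lex_less c d \<or> lex_less d c"
  by (erule first_difference) (metis lex_less_def linorder_neqE_nat)

lemma lex_less_le_trans: "lex_less c d \<Longrightarrow> \<not> lex_less e d \<Longrightarrow> lex_less c e"
  by (metis lex_total lex_trans)

lemma lex_less_reflection:
  assumes "lex_less c d" "\<forall>i. c i \<le> M" "\<forall>i. d i \<le> M"
  shows "lex_less (reflection M d) (reflection M c)"
proof -
  obtain j where j: "\<forall>i<j. c i = d i" "c j < d j" using assms(1) by (rule lex_lessE)
  show ?thesis
    by (rule lex_lessI[of j]) (use j spec[OF assms(3), of j] in auto)
qed

section \<open>Values of digit sequences\<close>

text \<open>
  The value $\sum_{i\ge 1} c_i q^{-i}$. It is meaningful for bounded sequences and $q > 1$, where the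
  series converges.
\<close>

definition base_value :: "real \<Rightarrow> (nat \<Rightarrow> nat) \<Rightarrow> real" where
  "base_value q c = (\<Sum>i. real (c i) / q ^ Suc i)"

text \<open>
  Boundedness guarantees that the series defining the value converges in every base above 1.
\<close>

definition bounded_digits :: "(nat \<Rightarrow> nat) \<Rightarrow> bool" where
  "bounded_digits c \<longleftrightarrow> (\<exists>B. \<forall>i. c i \<le> B)"

lemma bounded_digits_tail [simp]: "bounded_digits c \<Longrightarrow> bounded_digits (tail n c)"
  by (auto simp: bounded_digits_def)

lemma bounded_digitsI: "\<forall>i. c i \<le> B \<Longrightarrow> bounded_digits c"
  by (auto simp: bounded_digits_def)

lemma const_digits_sums:
  fixes q b :: real
  assumes "q > 1"
  shows "(\<lambda>i. b / q ^ Suc i) sums (b / (q - 1))"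
proof -
  have "(\<lambda>i. (b / q) * (1 / q) ^ i) sums ((b / q) * (1 / (1 - 1 / q)))"
    by (intro sums_mult geometric_sums) (use assms in auto)
  also have "(\<lambda>i. (b / q) * (1 / q) ^ i) = (\<lambda>i. b / q ^ Suc i)"
    by (auto simp: power_divide)
  also have "(b / q) * (1 / (1 - 1 / q)) = b / (q - 1)"
    using assms by (simp add: field_simps)
  finally show ?thesis .
qed

lemma summable_digits:
  assumes "q > 1" "bounded_digits c"
  shows "summable (\<lambda>i. real (c i) / q ^ Suc i)"
proof -
  obtain B where B: "\<forall>i. c i \<le> B" using assms(2) by (auto simp: bounded_digits_def)
  have "summable (\<lambda>i. real B / q ^ Suc i)"
    using const_digits_sums[OF assms(1)] by (rule sums_summable)
  then show ?thesis
    by (rule summable_comparison_test'[where N = 0]) (use assms(1) B in \<open>auto intro!: divide_right_mono\<close>)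
qed

lemma base_value_nonneg:
  assumes "q > 1" "bounded_digits c"
  shows "0 \<le> base_value q c"
  unfolding base_value_def by (intro suminf_nonneg summable_digits assms) (use assms in auto)

lemma base_value_le:
  assumes "q > 1" "\<forall>i. c i \<le> B"
  shows "base_value q c \<le> real B / (q - 1)"
proof -
  have "base_value q c \<le> (\<Sum>i. real B / q ^ Suc i)"
    unfolding base_value_def
    by (intro suminf_le summable_digits sums_summable[OF const_digits_sums] bounded_digitsI)
       (use assms in \<open>auto intro!: divide_right_mono\<close>)
  then show ?thesis using const_digits_sums[OF assms(1)] by (simp add: sums_iff)
qed

lemma base_value_pos_iff:
  assumes "q > 1" "bounded_digits c"
  shows "0 < base_value q c \<longleftrightarrow> (\<exists>i. c i > 0)"
proof -
  have "0 < base_value q c \<longleftrightarrow> (\<exists>i. 0 < real (c i) / q ^ Suc i)"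
    unfolding base_value_def by (intro suminf_pos_iff summable_digits assms) (use assms in auto)
  then show ?thesis using assms by (auto simp: zero_less_divide_iff)
qed

lemma base_value_reflection:
  assumes "q > 1" "\<forall>i. c i \<le> M"
  shows "base_value q (reflection M c) = real M / (q - 1) - base_value q c"
proof -
  have "(\<lambda>i. real M / q ^ Suc i - real (c i) / q ^ Suc i) sums (real M / (q - 1) - base_value q c)"
    unfolding base_value_def
    by (intro sums_diff const_digits_sums summable_sums summable_digits bounded_digitsI[OF assms(2)] assms)
  then have "(\<lambda>i. real (reflection M c i) / q ^ Suc i) sums (real M / (q - 1) - base_value q c)"
    using assms(2) by (simp add: of_nat_diff diff_divide_distrib)
  then show ?thesis by (simp add: base_value_def sums_iff)
qed

lemma base_value_split:
  assumes "q > 1" "bounded_digits c"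
  shows "base_value q c = (\<Sum>i<n. real (c i) / q ^ Suc i) + base_value q (tail n c) / q ^ n"
proof -
  have "base_value q c = (\<Sum>i. real (c (i + n)) / q ^ Suc (i + n)) + (\<Sum>i<n. real (c i) / q ^ Suc i)"
    unfolding base_value_def by (intro suminf_split_initial_segment summable_digits assms)
  also have "(\<lambda>i. real (c (i + n)) / q ^ Suc (i + n)) = (\<lambda>i. real (tail n c i) / q ^ Suc i / q ^ n)"
    by (auto simp: power_add add.commute)
  also have "(\<Sum>i. real (tail n c i) / q ^ Suc i / q ^ n) = base_value q (tail n c) / q ^ n"
    unfolding base_value_def
    by (intro suminf_divide summable_digits bounded_digits_tail assms)
  finally show ?thesis by simp
qed

lemma base_value_step:
  assumes "q > 1" "bounded_digits c"
  shows "base_value q (tail n c) * q = real (c n) + base_value q (tail (Suc n) c)"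
  using base_value_split[OF assms(1) bounded_digits_tail[OF assms(2), of n], of 1] assms(1)
  by (simp add: field_simps)

text \<open>
  Comparisons of values and lexicographic comparisons are linked through this identity at the first
  index where two sequences differ.
\<close>

lemma base_value_first_difference:
  assumes "q > 1" "bounded_digits c" "bounded_digits d" "\<And>i. i < j \<Longrightarrow> c i = d i"
  shows "base_value q c - base_value q d =
    (real (c j) - real (d j) + base_value q (tail (Suc j) c) - base_value q (tail (Suc j) d)) / q ^ Suc j"
  using base_value_split[OF assms(1,2), of "Suc j"] base_value_split[OF assms(1,3), of "Suc j"] assms(4)
  by (simp add: diff_divide_distrib add_divide_distrib)

section \<open>Quasi-greedy expansions of 1\<close>

text \<open>
  An expansion of 1 whose tails all have value in the interval $(0,1]$. This is the lexicographically
  largest expansion of 1 with infinitely many nonzero digits: its digits are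
  $\lceil q r_n\rceil - 1$, where $r_n$ is the value of the $n$-th tail. The bound by the maximal digit
  follows and is not part of the definition.
\<close>

definition quasi_greedy :: "real \<Rightarrow> (nat \<Rightarrow> nat) \<Rightarrow> bool" where
  "quasi_greedy q a \<longleftrightarrow> bounded_digits a \<and> base_value q a = 1 \<and>
     (\<forall>n. 0 < base_value q (tail n a) \<and> base_value q (tail n a) \<le> 1)"

lemma max_digit_iff:
  assumes "q > 1"
  shows "real d < q \<longleftrightarrow> d \<le> max_digit q"
  unfolding max_digit_def using assms by linarith

lemma max_digit_bounds:
  assumes "q > 1"
  shows "1 \<le> max_digit q" "real (max_digit q) < q" "q \<le> real (max_digit q) + 1"
  unfolding max_digit_def using assms by linarith+

lemma quasi_greedyD:
  assumes "quasi_greedy q a"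
  shows "bounded_digits a" "base_value q a = 1"
    "0 < base_value q (tail n a)" "base_value q (tail n a) \<le> 1"
  using assms by (auto simp: quasi_greedy_def)

lemma quasi_greedy_first_digit:
  assumes "q > 1" "quasi_greedy q a"
  shows "a 0 = max_digit q"
proof -
  have "q = real (a 0) + base_value q (tail (Suc 0) a)"
    using base_value_step[OF assms(1) quasi_greedyD(1)[OF assms(2)], of 0] quasi_greedyD(2)[OF assms(2)]
    by simp
  then show ?thesis
    using quasi_greedyD(3,4)[OF assms(2), of "Suc 0"] max_digit_bounds[OF assms(1)]
    by linarith
qed

lemma quasi_greedy_digit_le:
  assumes "q > 1" "quasi_greedy q a"
  shows "a n \<le> max_digit q"
proof -
  have "real (a n) + base_value q (tail (Suc n) a) = base_value q (tail n a) * q"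
    using base_value_step[OF assms(1) quasi_greedyD(1)[OF assms(2)], of n] by simp
  also have "\<dots> \<le> 1 * q"
    using assms(1) quasi_greedyD(4)[OF assms(2)] by (intro mult_right_mono) auto
  finally show ?thesis
    using quasi_greedyD(3)[OF assms(2), of "Suc n"] max_digit_iff[OF assms(1), of "a n"] by simp
qed

text \<open>
  Digits produced by any algorithm with remainders $r_{n+1} = q r_n - a_n$ that stay bounded sum to the
  initial remainder.
\<close>

lemma expansion_algorithm:
  fixes r :: "nat \<Rightarrow> real"
  assumes "q > 1" "\<And>i. r (Suc i) = q * r i - real (a i)" "\<And>i. \<bar>r i\<bar> \<le> C" "bounded_digits a"
  shows "base_value q (tail n a) = r n"
proof -
  have *: "base_value q a = r 0" if "\<And>i. r (Suc i) = q * r i - real (a i)" "\<And>i. \<bar>r i\<bar> \<le> C" "bounded_digits a"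
    for r :: "nat \<Rightarrow> real" and a
  proof -
    have part: "(\<Sum>i<k. real (a i) / q ^ Suc i) = r 0 - r k / q ^ k" for k
      by (induction k) (use \<open>q > 1\<close> in \<open>simp_all add: that(1) diff_divide_distrib\<close>)
    have C: "0 \<le> C" using that(2)[of 0] by linarith
    have "(\<lambda>k. C * (1 / q) ^ k) \<longlonglongrightarrow> C * 0"
      by (intro tendsto_mult tendsto_const LIMSEQ_realpow_zero) (use \<open>q > 1\<close> in auto)
    then have lim0: "(\<lambda>k. C * (1 / q) ^ k) \<longlonglongrightarrow> 0" by simp
    have "(\<lambda>k. r k / q ^ k) \<longlonglongrightarrow> 0"
    proof (rule Lim_null_comparison[OF _ lim0])
      show "\<forall>\<^sub>F k in sequentially. norm (r k / q ^ k) \<le> C * (1 / q) ^ k"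
        using that(2) \<open>q > 1\<close> by (intro always_eventually) (auto simp: power_divide divide_right_mono)
    qed
    then have "(\<lambda>k. r 0 - r k / q ^ k) \<longlonglongrightarrow> r 0 - 0"
      by (intro tendsto_diff tendsto_const)
    then have "(\<lambda>i. real (a i) / q ^ Suc i) sums r 0"
      unfolding sums_def part by simp
    then show ?thesis by (simp add: base_value_def sums_iff)
  qed
  show ?thesis
    using *[of "\<lambda>i. r (n + i)" "tail n a"] assms by simp
qed

lemma quasi_greedy_exists:
  assumes "q > 1"
  shows "\<exists>a. quasi_greedy q a"
proof -
  define f where "f x = q * x - real (nat (\<lceil>q * x\<rceil> - 1))" for x
  define r where "r n = (f ^^ n) 1" for n
  define a where "a n = nat (\<lceil>q * r n\<rceil> - 1)" for n
  have rS: "r (Suc n) = q * r n - real (a n)" for n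
    by (simp add: r_def a_def f_def)
  have r: "0 < r n \<and> r n \<le> 1" for n
  proof (induction n)
    case 0 then show ?case by (simp add: r_def)
  next
    case (Suc n)
    then have "0 < q * r n" using assms by simp
    then show ?case unfolding rS a_def by linarith
  qed
  have bd: "bounded_digits a"
  proof (rule bounded_digitsI, rule allI)
    fix n
    have "q * r n \<le> q * 1" using r[of n] assms by (intro mult_left_mono) auto
    then show "a n \<le> nat \<lceil>q\<rceil>" unfolding a_def by (intro nat_mono) linarith
  qed
  have "base_value q (tail n a) = r n" for n
    by (rule expansion_algorithm[where C = 1, OF assms rS _ bd]) (use r in \<open>auto simp: less_imp_le\<close>)
  then show ?thesis
    using r bd tail_0 unfolding quasi_greedy_def by (metis r_def funpow_0)
qed

lemma expansion_exists:
  assumes "q > 1" "0 \<le> x" "x \<le> real (max_digit q) / (q - 1)"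
  shows "\<exists>c. (\<forall>i. c i \<le> max_digit q) \<and> base_value q c = x"
proof -
  define M where "M = max_digit q"
  define g where "g x = min M (nat \<lfloor>q * x\<rfloor>)" for x
  define f where "f x = q * x - real (g x)" for x
  define r where "r n = (f ^^ n) x" for n
  define a where "a n = g (r n)" for n
  have rS: "r (Suc n) = q * r n - real (a n)" for n
    by (simp add: r_def a_def f_def)
  have MB: "1 \<le> real M / (q - 1)"
    using max_digit_bounds[OF assms(1)] assms(1) by (simp add: M_def field_simps)
  have r: "0 \<le> r n \<and> r n \<le> real M / (q - 1)" for n
  proof (induction n)
    case 0 then show ?case using assms by (simp add: r_def M_def)
  next
    case (Suc n)
    then have nn: "0 \<le> q * r n" using assms(1) by simp
    show ?case
    proof (cases "nat \<lfloor>q * r n\<rfloor> \<le> M")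
      case True
      then have "a n = nat \<lfloor>q * r n\<rfloor>" by (simp add: a_def g_def)
      with nn have "0 \<le> r (Suc n)" "r (Suc n) \<le> 1"
        unfolding rS by linarith+
      then show ?thesis using MB by linarith
    next
      case False
      then have aM: "a n = M" by (simp add: a_def g_def)
      have "q * r n \<le> q * (real M / (q - 1))"
        using Suc assms(1) by (intro mult_left_mono) auto
      also have "\<dots> = real M + real M / (q - 1)" using assms(1) by (simp add: field_simps)
      finally have "r (Suc n) \<le> real M / (q - 1)" unfolding rS aM by simp
      moreover have "real M \<le> q * r n" using False by linarith
      ultimately show ?thesis unfolding rS aM by simp
    qed
  qed
  have aM: "\<forall>i. a i \<le> M" by (simp add: a_def g_def)
  have "base_value q (tail 0 a) = r 0"
    by (rule expansion_algorithm[where C = "real M / (q - 1)", OF assms(1) rS _ bounded_digitsI[OF aM]])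
       (use r in \<open>auto simp: abs_le_iff intro: order.trans[of _ 0]\<close>)
  then show ?thesis using aM by (auto simp: r_def M_def)
qed

text \<open>
  The step from lexicographic to value comparisons. The set $T$ of start indices is closed under
  passing from a tail to the part behind its first deviation from $a$. Each such passage divides the
  possible excess of the value over 1 by at least $q$, so there is no excess.
\<close>

lemma lex_dominated_value_le_1:
  assumes "q > 1" "bounded_digits c" "bounded_digits a" "base_value q a = 1"
    and step: "\<And>k. T k \<Longrightarrow> tail k c \<noteq> a \<Longrightarrow>
                 \<exists>j. (\<forall>i<j. c (k + i) = a i) \<and> c (k + j) < a j \<and> T (Suc (k + j))"
    and "T k"
  shows "base_value q (tail k c) \<le> 1"
proof -
  obtain B where B: "\<forall>i. c i \<le> B" using assms(2) by (auto simp: bounded_digits_def)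
  define K where "K = real B / (q - 1)"
  have K0: "0 \<le> K" using assms(1) by (simp add: K_def)
  \<comment> \<open>\<open>K\<close> bounds the values of all tails of \<open>c\<close>, so it bounds the excess trivially.\<close>
  have bound: "\<forall>k. T k \<longrightarrow> base_value q (tail k c) \<le> 1 + K / q ^ n" for n
  proof (induction n)
    case 0
    have le_K: "base_value q (tail k c) \<le> K" for k
      unfolding K_def by (rule base_value_le) (use assms B in auto)
    then have "base_value q (tail k c) \<le> 1 + K" for k
      using le_K[of k] by linarith
    then show ?case unfolding power_0 div_by_1 by blast
  next
    case (Suc n)
    show ?case
    proof (intro allI impI)
      fix k assume k: "T k"
      show "base_value q (tail k c) \<le> 1 + K / q ^ Suc n"
      proof (cases "tail k c = a")
        case True
        then show ?thesis using assms(1,4) K0 by simp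
      next
        case False
        then obtain j where j: "\<forall>i<j. c (k + i) = a i" "c (k + j) < a j" "T (Suc (k + j))"
          using step[OF k] by blast
        have "base_value q (tail k c) - base_value q a =
          (real (c (k + j)) - real (a j) + base_value q (tail (Suc (k + j)) c)
             - base_value q (tail (Suc j) a)) / q ^ Suc j"
          using base_value_first_difference[OF assms(1) bounded_digits_tail[OF assms(2), of k] assms(3), of j] j(1)
          by simp
        also have "\<dots> \<le> (K / q ^ n) / q ^ Suc j"
        proof (rule divide_right_mono)
          have "base_value q (tail (Suc (k + j)) c) \<le> 1 + K / q ^ n" using Suc j(3) by blast
          moreover have "0 \<le> base_value q (tail (Suc j) a)"
            by (intro base_value_nonneg bounded_digits_tail assms)
          moreover have "real (c (k + j)) + 1 \<le> real (a j)" using j(2) by linarith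
          ultimately show "real (c (k + j)) - real (a j) + base_value q (tail (Suc (k + j)) c)
             - base_value q (tail (Suc j) a) \<le> K / q ^ n" by linarith
        qed (use assms(1) in auto)
        also have "\<dots> \<le> (K / q ^ n) / q ^ 1"
          by (intro divide_left_mono power_increasing) (use assms(1) K0 in auto)
        finally show ?thesis using assms(4) by (simp add: field_simps)
      qed
    qed
  qed
  have "(\<lambda>n. 1 + K * (1 / q) ^ n) \<longlonglongrightarrow> 1 + K * 0"
    by (intro tendsto_intros LIMSEQ_realpow_zero) (use assms(1) in auto)
  moreover have "\<forall>n. base_value q (tail k c) \<le> 1 + K * (1 / q) ^ n"
    using bound \<open>T k\<close> by (simp add: power_divide)
  ultimately show ?thesis by (intro LIMSEQ_le_const) auto
qed

lemma quasi_greedy_greatest: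
  assumes "q > 1" "quasi_greedy q a" "bounded_digits d" "\<And>n. 0 < base_value q (tail n d)"
    "base_value q d \<le> 1"
  shows "\<not> lex_less a d"
proof
  assume "lex_less a d"
  then obtain j where j: "\<forall>i<j. a i = d i" "a j < d j" by (rule lex_lessE)
  have "base_value q a - base_value q d =
    (real (a j) - real (d j) + base_value q (tail (Suc j) a) - base_value q (tail (Suc j) d)) / q ^ Suc j"
    by (rule base_value_first_difference) (use assms quasi_greedyD(1)[OF assms(2)] j in auto)
  also have "\<dots> < 0"
  proof (rule divide_neg_pos)
    have "real (a j) + 1 \<le> real (d j)" using j(2) by linarith
    then show "real (a j) - real (d j) + base_value q (tail (Suc j) a) - base_value q (tail (Suc j) d) < 0"
      using quasi_greedyD(4)[OF assms(2), of "Suc j"] assms(4)[of "Suc j"] by linarith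
  qed (use assms(1) in auto)
  finally show False using quasi_greedyD(2)[OF assms(2)] assms(5) by linarith
qed

lemma quasi_greedy_tail_le:
  assumes "q > 1" "quasi_greedy q a"
  shows "\<not> lex_less a (tail n a)"
  by (rule quasi_greedy_greatest[OF assms]) (use quasi_greedyD[OF assms(2)] in auto)

lemma quasi_greedy_unique:
  assumes "q > 1" "quasi_greedy q a" "quasi_greedy q b"
  shows "a = b"
proof -
  have "\<not> lex_less a b"
    by (rule quasi_greedy_greatest[OF assms(1,2)]) (use quasi_greedyD[OF assms(3)] in auto)
  moreover have "\<not> lex_less b a"
    by (rule quasi_greedy_greatest[OF assms(1,3)]) (use quasi_greedyD[OF assms(2)] in auto)
  ultimately show ?thesis using lex_total by blast
qed

lemma tails_le_imp_digit_le:
  assumes "\<And>n. \<not> lex_less a (tail n a)"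
  shows "a n \<le> a 0"
  using assms[of n] lex_lessI[of 0 a "tail n a"] by force

text \<open>
  A sequence with infinitely many nonzero digits that dominates its tails is quasi-greedy in the base
  in which it represents 1.
\<close>

lemma quasi_greedyI:
  assumes "q > 1" "base_value q a = 1" and le: "\<And>n. \<not> lex_less a (tail n a)"
    and inf: "\<And>n. \<exists>i. a (n + i) > 0"
  shows "quasi_greedy q a"
proof -
  have bd: "bounded_digits a"
    using tails_le_imp_digit_le[OF le] by (auto intro: bounded_digitsI)
  have "base_value q (tail n a) \<le> 1" for n
  proof (rule lex_dominated_value_le_1[where T = "\<lambda>_. True" and a = a])
    fix k assume "tail k a \<noteq> a"
    then have "lex_less (tail k a) a" using lex_total le by blast
    then show "\<exists>j. (\<forall>i<j. a (k + i) = a i) \<and> a (k + j) < a j \<and> True"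
      by (auto simp: lex_less_def)
  qed (use assms bd in auto)
  moreover have "0 < base_value q (tail n a)" for n
    using inf[of n] base_value_pos_iff[OF assms(1) bounded_digits_tail[OF bd, of n]] by simp
  ultimately show ?thesis using bd assms(2) by (auto simp: quasi_greedy_def)
qed

lemma value_less_1_imp_lex_less:
  assumes "q > 1" "quasi_greedy q a" "bounded_digits d" "base_value q d < 1"
  shows "lex_less d a"
proof (rule ccontr)
  assume "\<not> lex_less d a"
  moreover have "d \<noteq> a" using assms(4) quasi_greedyD(2)[OF assms(2)] by auto
  ultimately have "lex_less a d" using lex_total by blast
  then obtain j where j: "\<forall>i<j. a i = d i" "a j < d j" by (rule lex_lessE)
  have "base_value q a - base_value q d =
    (real (a j) - real (d j) + base_value q (tail (Suc j) a) - base_value q (tail (Suc j) d)) / q ^ Suc j"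
    by (rule base_value_first_difference) (use assms quasi_greedyD(1)[OF assms(2)] j in auto)
  also have "\<dots> \<le> 0"
  proof (rule divide_nonpos_pos)
    have "real (a j) + 1 \<le> real (d j)" using j(2) by linarith
    then show "real (a j) - real (d j) + base_value q (tail (Suc j) a) - base_value q (tail (Suc j) d) \<le> 0"
      using quasi_greedyD(4)[OF assms(2), of "Suc j"]
        base_value_nonneg[OF assms(1) bounded_digits_tail[OF assms(3), of "Suc j"]] by linarith
  qed (use assms(1) in auto)
  finally show False using quasi_greedyD(2)[OF assms(2)] assms(4) by linarith
qed

text \<open>
  The quantification over all $n$ matters for the implication from right to left: the digit at the first
  deviation from $a$ is again below the maximum, so the hypothesis applies once more behind it.
  Strictness comes from the positive values of the tails of $a$.
\<close>

lemma tails_value_iff_lex: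
  assumes "q > 1" "quasi_greedy q a" "\<forall>i. c i \<le> max_digit q"
  shows "(\<forall>n. c n < max_digit q \<longrightarrow> base_value q (tail (Suc n) c) < 1) \<longleftrightarrow>
         (\<forall>n. c n < max_digit q \<longrightarrow> lex_less (tail (Suc n) c) a)"
    (is "?V \<longleftrightarrow> ?L")
proof
  have bd: "bounded_digits c" using assms(3) by (rule bounded_digitsI)
  note abd = quasi_greedyD(1)[OF assms(2)]
  show ?L if ?V
    using that value_less_1_imp_lex_less[OF assms(1,2) bounded_digits_tail[OF bd]] by blast
  assume L: ?L
  define T where "T k \<longleftrightarrow> (\<exists>n. k = Suc n \<and> c n < max_digit q)" for k
  have step: "\<exists>j. (\<forall>i<j. c (k + i) = a i) \<and> c (k + j) < a j \<and> T (Suc (k + j))" if k: "T k" for k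
  proof -
    obtain n where n: "k = Suc n" "c n < max_digit q" using k by (auto simp: T_def)
    then have "lex_less (tail k c) a" using L by blast
    then obtain j where j: "\<forall>i<j. tail k c i = a i" "tail k c j < a j" by (rule lex_lessE)
    have "T (Suc (k + j))"
      using j(2) quasi_greedy_digit_le[OF assms(1,2), of j] by (auto simp: T_def)
    then show ?thesis using j by auto
  qed
  have le1: "base_value q (tail k c) \<le> 1" if "T k" for k
    by (rule lex_dominated_value_le_1[where T = T, OF assms(1) bd abd quasi_greedyD(2)[OF assms(2)] step that])
  show ?V
  proof (intro allI impI)
    fix n assume "c n < max_digit q"
    then have "T (Suc n)" by (auto simp: T_def)
    then obtain j where j: "\<forall>i<j. c (Suc n + i) = a i" "c (Suc n + j) < a j" "T (Suc (Suc n + j))"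
      using step by blast
    have "base_value q (tail (Suc n) c) - base_value q a =
      (real (c (Suc n + j)) - real (a j) + base_value q (tail (Suc (Suc n + j)) c)
         - base_value q (tail (Suc j) a)) / q ^ Suc j"
      using base_value_first_difference[OF assms(1) bounded_digits_tail[OF bd, of "Suc n"] abd, of j] j(1)
      by simp
    also have "\<dots> < 0"
    proof (rule divide_neg_pos)
      have "real (c (Suc n + j)) + 1 \<le> real (a j)" using j(2) by linarith
      then show "real (c (Suc n + j)) - real (a j) + base_value q (tail (Suc (Suc n + j)) c)
         - base_value q (tail (Suc j) a) < 0"
        using le1[OF j(3)] quasi_greedyD(3)[OF assms(2), of "Suc j"] by linarith
    qed (use assms(1) in auto)
    finally show "base_value q (tail (Suc n) c) < 1" using quasi_greedyD(2)[OF assms(2)] by simp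
  qed
qed

section \<open>Lexicographic characterization of unique expansions\<close>

lemma is_expansion_iff:
  assumes "q > 1"
  shows "is_expansion q x c \<longleftrightarrow> (\<forall>i. c i \<le> max_digit q) \<and> base_value q c = x"
proof -
  have "(\<lambda>i. real (c i) / q ^ Suc i) sums x \<longleftrightarrow> base_value q c = x" if "\<forall>i. c i \<le> max_digit q"
    using summable_digits[OF assms bounded_digitsI[OF that]] unfolding base_value_def sums_iff by simp
  then show ?thesis using max_digit_iff[OF assms] by (auto simp: is_expansion_def)
qed

lemma univoque_seqs_iff:
  assumes "q > 1"
  shows "c \<in> univoque_seqs q \<longleftrightarrow> (\<forall>i. c i \<le> max_digit q) \<and>
    (\<forall>d. (\<forall>i. d i \<le> max_digit q) \<longrightarrow> base_value q d = base_value q c \<longrightarrow> d = c)"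
  unfolding univoque_seqs_def univoque_set_def is_expansion_iff[OF assms] Bex_def mem_Collect_eq by metis

lemma univoque_bases_iff:
  assumes "q > 1" "quasi_greedy q a"
  shows "q \<in> univoque_bases \<longleftrightarrow> a \<in> univoque_seqs q"
proof -
  have a: "is_expansion q 1 a"
    using is_expansion_iff[OF assms(1)] quasi_greedy_digit_le[OF assms] quasi_greedyD(2)[OF assms(2)]
    by blast
  then have "is_expansion q x a \<longleftrightarrow> x = 1" for x
    using is_expansion_iff[OF assms(1)] by auto
  then show ?thesis
    using a assms(1) by (auto simp: univoque_bases_def univoque_seqs_def univoque_set_def)
qed

text \<open>
  If the tail after a non-maximal digit has value at least 1, that digit can be raised by one and the
  remaining value expanded anew.
\<close>

lemma second_expansion:
  assumes "q > 1" "\<forall>i. c i \<le> max_digit q" "c n < max_digit q" "1 \<le> base_value q (tail (Suc n) c)"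
  shows "\<exists>d. (\<forall>i. d i \<le> max_digit q) \<and> base_value q d = base_value q c \<and> d \<noteq> c"
proof -
  have bd: "bounded_digits c" using assms(2) by (rule bounded_digitsI)
  have "base_value q (tail (Suc n) c) \<le> real (max_digit q) / (q - 1)"
    by (rule base_value_le) (use assms in auto)
  then obtain e where e: "\<forall>i. e i \<le> max_digit q" "base_value q e = base_value q (tail (Suc n) c) - 1"
    using expansion_exists[OF assms(1), of "base_value q (tail (Suc n) c) - 1"] assms(4) by auto
  define d where "d i = (if i < n then c i else if i = n then Suc (c n) else e (i - Suc n))" for i
  have dM: "\<forall>i. d i \<le> max_digit q" using assms(2,3) e(1) by (auto simp: d_def)
  have te: "tail (Suc n) d = e" by (auto simp: d_def tail_def)
  have "base_value q d - base_value q c =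
    (real (d n) - real (c n) + base_value q (tail (Suc n) d) - base_value q (tail (Suc n) c)) / q ^ Suc n"
    by (rule base_value_first_difference[OF assms(1) bounded_digitsI[OF dM] bd]) (simp add: d_def)
  also have "\<dots> = 0" unfolding te e(2) by (simp add: d_def)
  finally have "base_value q d = base_value q c" by simp
  moreover have "d n \<noteq> c n" by (simp add: d_def)
  ultimately show ?thesis using dM by metis
qed

lemma univoque_seqs_value_iff:
  assumes "q > 1"
  shows "c \<in> univoque_seqs q \<longleftrightarrow> (\<forall>i. c i \<le> max_digit q) \<and>
    (\<forall>n. c n < max_digit q \<longrightarrow> base_value q (tail (Suc n) c) < 1) \<and>
    (\<forall>n. c n > 0 \<longrightarrow> base_value q (tail (Suc n) (reflection (max_digit q) c)) < 1)"
    (is "_ \<longleftrightarrow> ?D \<and> ?V \<and> ?R")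
proof (cases ?D)
  case False
  then show ?thesis using univoque_seqs_iff[OF assms] by blast
next
  case D: True
  let ?M = "max_digit q"
  have bd: "bounded_digits c" using D by (rule bounded_digitsI)
  show ?thesis
  proof
    assume U: "c \<in> univoque_seqs q"
    have ?V
      using second_expansion[OF assms D] U unfolding univoque_seqs_iff[OF assms] by (meson not_le)
    moreover have ?R
    proof (intro allI impI, rule ccontr)
      fix n assume n: "c n > 0" "\<not> base_value q (tail (Suc n) (reflection ?M c)) < 1"
      have "c n \<le> ?M" using D by blast
      then have "\<exists>d. (\<forall>i. d i \<le> ?M) \<and> base_value q d = base_value q (reflection ?M c) \<and> d \<noteq> reflection ?M c"
        using n by (intro second_expansion[OF assms, where n = n]) auto
      then obtain d where d: "\<forall>i. d i \<le> ?M" "base_value q d = base_value q (reflection ?M c)"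
        "d \<noteq> reflection ?M c" by blast
      have "base_value q (reflection ?M d) = base_value q c"
        using base_value_reflection[OF assms d(1)] base_value_reflection[OF assms D] d(2) by simp
      moreover have "\<forall>i. reflection ?M d i \<le> ?M" by simp
      ultimately have "reflection ?M d = c"
        using U univoque_seqs_iff[OF assms] by blast
      then show False using d(3) reflection_reflection[OF d(1)] by auto
    qed
    ultimately show "?D \<and> ?V \<and> ?R" using D by blast
  next
    assume H: "?D \<and> ?V \<and> ?R"
    show "c \<in> univoque_seqs q"
      unfolding univoque_seqs_iff[OF assms]
    proof (rule conjI[OF D], intro allI impI)
      fix d assume d: "\<forall>i. d i \<le> ?M" "base_value q d = base_value q c"
      have dbd: "bounded_digits d" using d(1) by (rule bounded_digitsI)
      show "d = c"
      proof (rule ccontr)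
        assume "d \<noteq> c"
        then obtain n where n: "\<forall>i<n. d i = c i" "d n \<noteq> c n" by (rule first_difference)
        have "0 = (real (d n) - real (c n) + base_value q (tail (Suc n) d) - base_value q (tail (Suc n) c)) / q ^ Suc n"
          using base_value_first_difference[OF assms dbd bd, of n] n d(2) by simp
        then have eq: "real (c n) + base_value q (tail (Suc n) c) = real (d n) + base_value q (tail (Suc n) d)"
          using assms by simp
        show False
        proof (cases "c n < d n")
          case True
          then have "1 \<le> base_value q (tail (Suc n) c)"
            using eq base_value_nonneg[OF assms bounded_digits_tail[OF dbd, of "Suc n"]] by linarith
          moreover have "c n < ?M" using True d(1) by (meson order.strict_trans2)
          ultimately show False using H by (meson not_le)
        next
          case False
          with n(2) have less: "d n < c n" by simp
          have "base_value q (tail (Suc n) (reflection ?M c)) = real ?M / (q - 1) - base_value q (tail (Suc n) c)"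
            unfolding tail_reflection by (rule base_value_reflection[OF assms]) (use D in auto)
          moreover have "base_value q (tail (Suc n) d) \<le> real ?M / (q - 1)"
            by (rule base_value_le) (use assms d in auto)
          ultimately have "1 \<le> base_value q (tail (Suc n) (reflection ?M c))"
            using eq less by linarith
          moreover have "c n > 0" using less by simp
          ultimately show False using H by (meson not_le)
        qed
      qed
    qed
  qed
qed

lemma univoque_seqs_lex_iff:
  assumes "q > 1" "quasi_greedy q a"
  shows "c \<in> univoque_seqs q \<longleftrightarrow> (\<forall>i. c i \<le> max_digit q) \<and>
    (\<forall>n. c n < max_digit q \<longrightarrow> lex_less (tail (Suc n) c) a) \<and>
    (\<forall>n. c n > 0 \<longrightarrow> lex_less (reflection (max_digit q) (tail (Suc n) c)) a)"
proof (cases "\<forall>i. c i \<le> max_digit q")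
  case False
  then show ?thesis using univoque_seqs_value_iff[OF assms(1)] by blast
next
  case True
  have "max_digit q - c n < max_digit q \<longleftrightarrow> c n > 0" for n
    using max_digit_bounds(1)[OF assms(1)] spec[OF True, of n] by linarith
  then show ?thesis
    unfolding univoque_seqs_value_iff[OF assms(1)]
    using tails_value_iff_lex[OF assms True] tails_value_iff_lex[OF assms, of "reflection (max_digit q) c"]
    by (simp add: tail_reflection)
qed

section \<open>Sequences dominating the reflections of their tails\<close>

text \<open>
  The reflections of all proper tails are smaller than the sequence. The digits are reflected at
  \<open>a 0\<close>, which for a quasi-greedy expansion in base $q$ equals the maximal digit; in this form the
  notion does not mention the base.
\<close>

definition reflection_dominated :: "(nat \<Rightarrow> nat) \<Rightarrow> bool" where
  "reflection_dominated a \<longleftrightarrow> (\<forall>n\<ge>1. lex_less (reflection (a 0) (tail n a)) a)"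

lemma reflection_dominatedD:
  assumes "reflection_dominated a" "n \<ge> 1"
  shows "lex_less (reflection (a 0) (tail n a)) a"
  using assms unfolding reflection_dominated_def by blast

text \<open>
  The hypothesis only concerns tails after positive digits, but it propagates over zeros: the
  reflection of a zero is the maximal digit \<open>a 0\<close>, so deleting it on one side and \<open>a 0\<close> on the
  other side preserves the inequality, and the tail of \<open>a\<close> does not exceed \<open>a\<close>.
\<close>

lemma reflection_less_after_positive_digit:
  assumes le: "\<And>n. \<not> lex_less a (tail n a)"
    and pos: "\<And>n. c n > 0 \<Longrightarrow> lex_less (reflection (a 0) (tail (Suc n) c)) a"
    and "\<exists>i\<le>n. c i > 0"
  shows "lex_less (reflection (a 0) (tail (Suc n) c)) a"
  using assms(3)
proof (induction n)
  case 0
  then have "c 0 > 0" by simp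
  then show ?case by (rule pos)
next
  case (Suc n)
  show ?case
  proof (cases "c (Suc n) > 0")
    case True
    then show ?thesis by (rule pos)
  next
    case False
    then have "\<exists>i\<le>n. c i > 0" using Suc.prems le_Suc_eq by auto
    then have "lex_less (reflection (a 0) (tail (Suc n) c)) a" by (rule Suc.IH)
    then obtain j where j: "\<forall>i<j. reflection (a 0) (tail (Suc n) c) i = a i"
      "reflection (a 0) (tail (Suc n) c) j < a j" by (rule lex_lessE)
    have "j \<noteq> 0"
    proof
      assume "j = 0"
      then show False using j(2) False by simp
    qed
    then obtain j' where j': "j = Suc j'" using not0_implies_Suc by blast
    have "lex_less (reflection (a 0) (tail (Suc (Suc n)) c)) (tail 1 a)"
    proof (rule lex_lessI[of j'])
      show "reflection (a 0) (tail (Suc (Suc n)) c) i = tail 1 a i" if "i < j'" for i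
        using j(1) that unfolding j' by (auto dest!: spec[of _ "Suc i"])
      show "reflection (a 0) (tail (Suc (Suc n)) c) j' < tail 1 a j'"
        using j(2) unfolding j' by simp
    qed
    then show ?thesis using le[of 1] lex_less_le_trans by blast
  qed
qed

lemma reflection_dominated_if_univoque:
  assumes "q > 1" "quasi_greedy q a" "q \<in> univoque_bases"
  shows "reflection_dominated a"
  unfolding reflection_dominated_def
proof (intro allI impI)
  fix n :: nat assume "1 \<le> n"
  then obtain n' where n': "n = Suc n'" by (cases n) auto
  have "a \<in> univoque_seqs q" using univoque_bases_iff[OF assms(1,2)] assms(3) by blast
  then have "\<And>n. a n > 0 \<Longrightarrow> lex_less (reflection (a 0) (tail (Suc n) a)) a"
    unfolding univoque_seqs_lex_iff[OF assms(1,2)] quasi_greedy_first_digit[OF assms(1,2)] by blast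
  moreover have "a 0 > 0"
    using quasi_greedy_first_digit[OF assms(1,2)] max_digit_bounds(1)[OF assms(1)] by simp
  ultimately show "lex_less (reflection (a 0) (tail n a)) a"
    unfolding n' using quasi_greedy_tail_le[OF assms(1,2)]
    by (metis reflection_less_after_positive_digit le0)
qed

lemma univoque_if_strictly_dominated:
  assumes "q > 1" "quasi_greedy q a" "\<And>n. n \<ge> 1 \<Longrightarrow> lex_less (tail n a) a" "reflection_dominated a"
  shows "q \<in> univoque_bases"
  unfolding univoque_bases_iff[OF assms(1,2)] univoque_seqs_lex_iff[OF assms(1,2)]
proof (intro conjI allI impI)
  show "a i \<le> max_digit q" for i by (rule quasi_greedy_digit_le[OF assms(1,2)])
  show "lex_less (tail (Suc n) a) a" for n by (rule assms(3)) simp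
  have "lex_less (reflection (a 0) (tail (Suc n) a)) a" for n
    by (rule reflection_dominatedD[OF assms(4)]) simp
  then show "lex_less (reflection (max_digit q) (tail (Suc n) a)) a" for n
    unfolding quasi_greedy_first_digit[OF assms(1,2)] .
qed

lemma reflection_dominated_infinite:
  assumes "\<And>i. a i \<le> a 0" "reflection_dominated a"
  shows "\<exists>i. a (n + i) > 0"
proof (rule ccontr)
  assume "\<not> ?thesis"
  then have "a (n + i) = 0" for i by simp
  then have z: "a (Suc n + i) = 0" for i by (metis add_Suc add_Suc_right)
  have "lex_less (reflection (a 0) (tail (Suc n) a)) a"
    by (rule reflection_dominatedD[OF assms(2)]) simp
  then obtain j where "reflection (a 0) (tail (Suc n) a) j < a j" by (rule lex_lessE)
  then have "a 0 < a j" using z[of j] by simp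
  then show False using assms(1)[of j] by simp
qed

text \<open>
  The reflection of every nonempty proper suffix of the word formed by the first $m$ digits is smaller
  than the sequence, and the comparison is decided inside that word.
\<close>

definition dominating_prefix :: "nat \<Rightarrow> (nat \<Rightarrow> nat) \<Rightarrow> bool" where
  "dominating_prefix m a \<longleftrightarrow>
     (\<forall>k. 1 \<le> k \<and> k < m \<longrightarrow> lex_below (m - k) (reflection (a 0) (tail k a)) a)"

lemma lex_below_mono: "lex_below N c d \<Longrightarrow> N \<le> N' \<Longrightarrow> lex_below N' c d"
  unfolding lex_below_def by (meson order.strict_trans2)

text \<open>
  If the prefix of length $N$ fails, take the least $k$ at which it fails and extend the prefix up to
  and including the index where the reflected tail from $k$ on first falls below \<open>a\<close>. The longer
  prefix works.
\<close>

lemma dominating_prefix_unbounded: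
  assumes le: "\<And>n. \<not> lex_less a (tail n a)" and dom: "reflection_dominated a"
  shows "\<exists>m\<ge>N. dominating_prefix m a"
proof (cases "dominating_prefix N a")
  case True
  then show ?thesis by blast
next
  case False
  define P where "P k \<longleftrightarrow> 1 \<le> k \<and> k < N \<and> \<not> lex_below (N - k) (reflection (a 0) (tail k a)) a" for k
  define k where "k = (LEAST k. P k)"
  have "\<exists>k. P k" using False by (auto simp: dominating_prefix_def P_def)
  then have Pk: "P k" unfolding k_def by (rule LeastI_ex)
  have min: "\<not> P j" if "j < k" for j using that unfolding k_def by (rule not_less_Least)
  have "lex_less (reflection (a 0) (tail k a)) a"
    using Pk dom by (auto simp: P_def reflection_dominated_def)
  then obtain l where l: "\<forall>i<l. reflection (a 0) (tail k a) i = a i" "reflection (a 0) (tail k a) l < a l"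
    by (rule lex_lessE)
  have lN: "N - k \<le> l"
  proof (rule ccontr)
    assume "\<not> N - k \<le> l"
    then have "lex_below (N - k) (reflection (a 0) (tail k a)) a"
      using l by (intro lex_belowI[of l]) auto
    then show False using Pk by (simp add: P_def)
  qed
  define m where "m = Suc (k + l)"
  have Nm: "N \<le> m" using lN Pk by (simp add: m_def P_def)
  have "lex_below (m - j) (reflection (a 0) (tail j a)) a" if j: "1 \<le> j" "j < m" for j
  proof (cases j k rule: linorder_cases)
    case less
    then have "lex_below (N - j) (reflection (a 0) (tail j a)) a"
      using min[OF less] j Pk by (auto simp: P_def)
    then show ?thesis by (rule lex_below_mono) (use Nm in auto)
  next
    case equal
    then show ?thesis using l by (intro lex_belowI[of l]) (auto simp: m_def)
  next
    case greater
    \<comment> \<open>Between \<open>k\<close> and the last index \<open>k + l\<close> of the new prefix the sequence copies the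
      reflection of \<open>a\<close>, so here the claim reduces to the fact that the tail of \<open>a\<close> from
      \<open>t\<close> on does not exceed \<open>a\<close>.\<close>
    define t where "t = j - k"
    have jt: "j = k + t" "t \<le> l" using greater j by (auto simp: t_def m_def)
    have eq: "a 0 - a (j + i) = a (t + i)" if "i < l - t" for i
      using l(1) that jt by (auto simp: add.assoc dest!: spec[of _ "t + i"])
    have lt: "a 0 - a (j + (l - t)) < a l"
      using l(2) jt by simp
    consider "\<forall>i<l - t. a (t + i) = a i" "a l \<le> a (l - t)"
      | p where "p < l - t" "\<forall>i<p. a (t + i) = a i" "a (t + p) < a p"
    proof (cases "tail t a = a")
      case True
      then have "a (t + i) = a i" for i by (metis tail_apply)
      then show ?thesis using that(1) jt(2) by (metis le_add_diff_inverse order_refl)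
    next
      case False
      then have "lex_less (tail t a) a" using le lex_total by blast
      then obtain p where p: "\<forall>i<p. tail t a i = a i" "tail t a p < a p" by (rule lex_lessE)
      show ?thesis
      proof (cases "p < l - t")
        case True
        then show ?thesis using that(2) p by simp
      next
        case F: False
        have "a (t + (l - t)) \<le> a (l - t)"
        proof (cases "p = l - t")
          case True
          then show ?thesis using p(2) by simp
        next
          case False
          then have "l - t < p" using F by simp
          then show ?thesis using p(1) by simp
        qed
        then show ?thesis using that(1) p F jt(2) by simp
      qed
    qed
    then show ?thesis
    proof cases
      case 1
      then show ?thesis
        using eq lt jt by (intro lex_belowI[of "l - t"]) (auto simp: m_def)
    next
      case 2
      then show ?thesis
        using eq jt by (intro lex_belowI[of p]) (auto simp: m_def)
    qed
  qed
  then have "dominating_prefix m a" by (auto simp: dominating_prefix_def)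
  then show ?thesis using Nm by blast
qed

section \<open>Sequences built from a dominating prefix\<close>

text \<open>
  The periodic repetition of the first $m$ digits with the last digit of the period lowered by one.
\<close>

definition lowered_period :: "nat \<Rightarrow> (nat \<Rightarrow> nat) \<Rightarrow> nat \<Rightarrow> nat" where
  "lowered_period m a i = (if i mod m = m - 1 then a (m - 1) - 1 else a (i mod m))"

text \<open>
  The first $m$ digits, followed by the reflection of the periodic sequence \<open>lowered_period\<close>. As $m$
  is a period, the index need not be shifted in the second part.
\<close>

definition prefix_then_reflection :: "nat \<Rightarrow> (nat \<Rightarrow> nat) \<Rightarrow> nat \<Rightarrow> nat" where
  "prefix_then_reflection m a i = (if i < m then a i else a 0 - lowered_period m a i)"

text \<open>
  The bound $m \ge 2$ makes the reflected word begin with 0 also after its last digit has been raised.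
\<close>

locale dominating_word =
  fixes a :: "nat \<Rightarrow> nat" and m :: nat
  assumes tails_le: "\<And>n. \<not> lex_less a (tail n a)"
    and length_ge: "m \<ge> 2"
    and dominating: "dominating_prefix m a"
begin

abbreviation "w \<equiv> lowered_period m a"
abbreviation "v \<equiv> prefix_then_reflection m a"

lemma digit_le: "a i \<le> a 0"
  by (rule tails_le_imp_digit_le) (rule tails_le)

lemma dominatingE:
  assumes "1 \<le> k" "k < m"
  obtains l where "k + l < m" "\<forall>i<l. a 0 - a (k + i) = a i" "a 0 - a (k + l) < a l"
proof -
  have "lex_below (m - k) (reflection (a 0) (tail k a)) a"
    using dominating assms by (auto simp: dominating_prefix_def)
  then show ?thesis using that by (auto simp: lex_below_def less_diff_conv add.commute)
qed

lemma last_digit_pos: "a (m - 1) > 0"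
proof -
  obtain l where "m - 1 + l < m" "\<forall>i<l. a 0 - a (m - 1 + i) = a i" "a 0 - a (m - 1 + l) < a l"
    using dominatingE[of "m - 1"] length_ge by force
  then show ?thesis by (cases l) (auto intro: gr0I)
qed

lemma first_digit_pos: "a 0 > 0"
  using last_digit_pos digit_le[of "m - 1"] by simp

lemma w_period: "w (n + i) = w (n mod m + i)"
  unfolding lowered_period_def by (simp add: mod_add_left_eq)

lemma w_prefix: "i < m - 1 \<Longrightarrow> w i = a i"
  by (simp add: lowered_period_def)

lemma w_last: "w (m - 1) = a (m - 1) - 1"
  using length_ge by (simp add: lowered_period_def)

lemma w_next: "w (m + i) = w i"
  by (simp add: lowered_period_def)

lemma w_le: "w i \<le> a 0"
  using digit_le[of "i mod m"] digit_le[of "m - 1"] by (auto simp: lowered_period_def)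

text \<open>
  The dominance of the suffix of length $r$, read in the other direction: reflecting both sides shows
  that the reflection of a prefix is smaller than the suffix of the same length. This decides
  comparisons that run over the end of a period.
\<close>

lemma reflected_prefix_less:
  assumes "1 \<le> r" "r < m"
  obtains l where "l < r" "\<forall>i<l. a 0 - a i = a (m - r + i)" "a 0 - a l < a (m - r + l)"
proof -
  obtain l where l: "m - r + l < m" "\<forall>i<l. a 0 - a (m - r + i) = a i" "a 0 - a (m - r + l) < a l"
    using dominatingE[of "m - r"] assms by force
  have "\<forall>i<l. a 0 - a i = a (m - r + i)" using l(2) digit_le by (metis diff_diff_cancel)
  moreover have "a 0 - a l < a (m - r + l)"
    using l(3) digit_le[of l] digit_le[of "m - r + l"] by linarith
  moreover have "l < r" using l(1) by linarith
  ultimately show ?thesis using that by blast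
qed

lemma w_tail_below: "lex_below m (tail n w) a"
proof -
  define r where "r = n mod m"
  have rm: "r < m" using length_ge by (simp add: r_def)
  have "lex_below m (tail r w) a"
  proof (cases "\<forall>i<m - 1 - r. a (r + i) = a i")
    case True
    have "w (m - 1) < a (m - 1 - r)"
    proof -
      have "a (r + (m - 1 - r)) \<le> a (m - 1 - r)"
      proof (rule ccontr)
        assume "\<not> ?thesis"
        then have "lex_less a (tail r a)"
          using True by (intro lex_lessI[of "m - 1 - r"]) auto
        then show False using tails_le by blast
      qed
      then show ?thesis using rm last_digit_pos unfolding w_last by simp
    qed
    then show ?thesis
      using True rm by (intro lex_belowI[of "m - 1 - r"]) (auto simp: w_prefix)
  next
    case False
    then have "tail r a \<noteq> a" by (metis tail_apply)
    then have "lex_less (tail r a) a" using tails_le lex_total by blast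
    then obtain p where p: "\<forall>i<p. tail r a i = a i" "tail r a p < a p" by (rule lex_lessE)
    have "p < m - 1 - r"
      using False p(1) by (metis linorder_not_less order.strict_trans2 tail_apply)
    then show ?thesis
      using p by (intro lex_belowI[of p]) (auto simp: w_prefix)
  qed
  then show ?thesis
    by (rule lex_below_cong) (auto simp: r_def w_period[of n])
qed

lemma w_reflected_tail_below: "lex_below m (reflection (a 0) (tail n w)) a"
proof -
  define r where "r = n mod m"
  have rm: "r < m" using length_ge by (simp add: r_def)
  have "lex_below m (reflection (a 0) (tail r w)) a"
  proof (cases "r = 0")
    case True
    then show ?thesis
      using length_ge first_digit_pos by (intro lex_belowI[of 0]) (auto simp: w_prefix)
  next
    case False
    then have r1: "1 \<le> r" by simp
    obtain l where l: "r + l < m" "\<forall>i<l. a 0 - a (r + i) = a i" "a 0 - a (r + l) < a l"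
      using dominatingE[OF r1 rm] .
    have pre: "a 0 - w (r + i) = a i" if "i < l" for i
      using that l by (simp add: w_prefix)
    show ?thesis
    proof (cases "a 0 - w (r + l) < a l")
      case True
      then show ?thesis
        using pre l(1) by (intro lex_belowI[of l]) auto
    next
      case nless: False
      \<comment> \<open>Lowering the last digit raises its reflection, which can turn the inequality at the end of
        the period into an equality; the comparison is then decided in the next period.\<close>
      have rl: "r + l = m - 1"
        using nless l(1,3) w_prefix[of "r + l"] by fastforce
      have eq: "a 0 - w (r + l) = a l"
        using nless l(3) last_digit_pos digit_le[of "m - 1"] unfolding rl w_last by linarith
      have pre2: "a 0 - w (r + i) = a i" if "i < m - r" for i
        using that pre eq rl by (cases "i = l") auto
      obtain t where t: "t < r" "\<forall>i<t. a 0 - a i = a (m - r + i)" "a 0 - a t < a (m - r + t)"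
        using reflected_prefix_less[OF r1 rm] .
      have wt: "w (r + (m - r + i)) = a i" if "i \<le> t" for i
        using w_next[of i] w_prefix[of i] that t(1) rm by simp
      show ?thesis
      proof (rule lex_belowI[of "m - r + t"])
        show "m - r + t < m" using t(1) rm by simp
        show "reflection (a 0) (tail r w) (m - r + t) < a (m - r + t)"
          using wt[of t] t(3) by simp
        fix i assume i: "i < m - r + t"
        show "reflection (a 0) (tail r w) i = a i"
        proof (cases "i < m - r")
          case True
          then show ?thesis using pre2 by simp
        next
          case False
          then obtain s where s: "i = m - r + s" using le_Suc_ex by (metis not_less)
          then show ?thesis using wt[of s] t(2) i by simp
        qed
      qed
    qed
  qed
  then show ?thesis
    by (rule lex_below_cong) (auto simp: r_def w_period[of n])
qed

lemma v_prefix: "i < m \<Longrightarrow> v i = a i"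
  by (simp add: prefix_then_reflection_def)

lemma v_suffix: "m \<le> i \<Longrightarrow> v i = a 0 - w i"
  by (simp add: prefix_then_reflection_def)

lemma v_0: "v 0 = a 0"
  using length_ge by (simp add: v_prefix)

lemma v_tail_below: assumes "1 \<le> n" shows "lex_less (tail n v) v"
proof (cases "m \<le> n")
  case True
  have "lex_below m (tail n v) v"
    by (rule lex_below_cong[OF w_reflected_tail_below[of n]]) (use True in \<open>auto simp: v_prefix v_suffix\<close>)
  then show ?thesis by (rule lex_below_imp_less)
next
  case False
  then have nm: "n < m" by simp
  show ?thesis
  proof (cases "\<forall>i<m - n. a (n + i) = a i")
    case True
    obtain t where t: "t < n" "\<forall>i<t. a 0 - a i = a (m - n + i)" "a 0 - a t < a (m - n + t)"
      using reflected_prefix_less[OF assms nm] .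
    have vt: "v (n + (m - n + i)) = a 0 - a i" if "i \<le> t" for i
      using w_next[of i] w_prefix[of i] v_suffix[of "m + i"] that t(1) nm by simp
    show ?thesis
    proof (rule lex_lessI[of "m - n + t"])
      show "tail n v (m - n + t) < v (m - n + t)"
        using vt[of t] t(1,3) nm by (simp add: v_prefix)
      fix i assume i: "i < m - n + t"
      show "tail n v i = v i"
      proof (cases "i < m - n")
        case T: True
        then show ?thesis using True by (simp add: v_prefix)
      next
        case False
        then obtain s where s: "i = m - n + s" using le_Suc_ex by (metis not_less)
        then show ?thesis using vt[of s] t(1,2) i nm by (simp add: v_prefix)
      qed
    qed
  next
    case False
    then have "tail n a \<noteq> a" by (metis tail_apply)
    then have "lex_less (tail n a) a" using tails_le lex_total by blast
    then obtain p where p: "\<forall>i<p. tail n a i = a i" "tail n a p < a p" by (rule lex_lessE)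
    have "p < m - n"
      using False p(1) by (metis linorder_not_less order.strict_trans2 tail_apply)
    then show ?thesis
      using p by (intro lex_lessI[of p]) (auto simp: v_prefix)
  qed
qed

lemma v_reflection_dominated: "reflection_dominated v"
  unfolding reflection_dominated_def
proof (intro allI impI)
  fix n :: nat assume n: "1 \<le> n"
  have "lex_below m (reflection (v 0) (tail n v)) v"
  proof (cases "m \<le> n")
    case True
    show ?thesis
      by (rule lex_below_cong[OF w_tail_below[of n]]) (use True w_le in \<open>auto simp: v_0 v_prefix v_suffix\<close>)
  next
    case False
    then obtain l where "n + l < m" "\<forall>i<l. a 0 - a (n + i) = a i" "a 0 - a (n + l) < a l"
      using dominatingE[OF n] by force
    then show ?thesis by (intro lex_belowI[of l]) (auto simp: v_0 v_prefix)
  qed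
  then show "lex_less (reflection (v 0) (tail n v)) v" by (rule lex_below_imp_less)
qed

end

section \<open>Bases close to univoque bases\<close>

text \<open>
  The condition \<open>reflection_dominated\<close> is strict and yet closed under digitwise limits, as long as
  the approximating sequences dominate their tails.
\<close>

lemma limit_of_reflection_dominated:
  assumes approx: "\<And>N. \<exists>b. (\<forall>i<N. b i = c i) \<and> (\<forall>n. \<not> lex_less b (tail n b)) \<and> reflection_dominated b"
  shows "\<not> lex_less c (tail k c)" "\<exists>i. c (n + i) > 0" "reflection_dominated c"
proof -
  show le: "\<not> lex_less c (tail k c)" for k
  proof
    assume "lex_less c (tail k c)"
    then obtain j where j: "\<forall>i<j. c i = tail k c i" "c j < tail k c j" by (rule lex_lessE)
    obtain b where b: "\<forall>i<Suc (k + j). b i = c i" "\<forall>n. \<not> lex_less b (tail n b)"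
      using approx[of "Suc (k + j)"] by blast
    have bc: "b i = c i" if "i \<le> k + j" for i using b(1) that by simp
    have "lex_less b (tail k b)"
    proof (rule lex_lessI[of j])
      show "b i = tail k b i" if "i < j" for i
        using spec[OF j(1), of i] that bc[of i] bc[of "k + i"] by simp
      show "b j < tail k b j"
        using j(2) bc[of j] bc[of "k + j"] by simp
    qed
    then show False using b(2) by blast
  qed
  have dig: "c i \<le> c 0" for i by (rule tails_le_imp_digit_le) (rule le)
  have pos: "c 0 > 0"
  proof -
    obtain b where b: "\<forall>i<Suc 0. b i = c i" "\<And>n. \<not> lex_less b (tail n b)" "reflection_dominated b"
      using approx[of "Suc 0"] by blast
    have le0: "b i \<le> b 0" for i by (rule tails_le_imp_digit_le) (rule b(2))
    obtain i where "b (0 + i) > 0" using reflection_dominated_infinite[OF le0 b(3)] by blast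
    then show ?thesis using le0[of i] b(1) by auto
  qed
  show "\<exists>i. c (n + i) > 0" for n
  proof (rule ccontr)
    assume "\<not> ?thesis"
    then have "c (n + i) = 0" for i by simp
    then have z: "c (Suc n + i) = 0" for i by (metis add_Suc add_Suc_right)
    obtain b where b: "\<forall>i<2 * Suc n + 1. b i = c i" "\<And>n. \<not> lex_less b (tail n b)" "reflection_dominated b"
      using approx[of "2 * Suc n + 1"] by blast
    have le0: "b i \<le> b 0" for i by (rule tails_le_imp_digit_le) (rule b(2))
    have b0: "b 0 > 0" using b(1) pos by simp
    have "lex_less (reflection (b 0) (tail (Suc n) b)) b"
      by (rule reflection_dominatedD[OF b(3)]) simp
    then obtain j where j: "\<forall>i<j. reflection (b 0) (tail (Suc n) b) i = b i"
      "reflection (b 0) (tail (Suc n) b) j < b j" by (rule lex_lessE)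
    \<comment> \<open>A long run of zeros reflects to a run of maximal digits, so \<open>b\<close> must begin with equally many
      of them; that run reaches into the zeros.\<close>
    have bz: "b (Suc n + i) = 0" if "i \<le> Suc n" for i
      using b(1) z[of i] that by simp
    show False
    proof (cases "j \<le> Suc n")
      case True
      then show False using j(2) bz[of j] le0[of j] by simp
    next
      case False
      then have "Suc n < j" by simp
      then have "reflection (b 0) (tail (Suc n) b) (Suc n) = b (Suc n)" using j(1) by blast
      then have "b 0 - b (Suc n + Suc n) = b (Suc n)" by simp
      then show False using bz[of "Suc n"] bz[of 0] b0 by simp
    qed
  qed
  show "reflection_dominated c"
    unfolding reflection_dominated_def
  proof (intro allI impI, rule ccontr)
    fix k :: nat assume k: "1 \<le> k" and nless: "\<not> lex_less (reflection (c 0) (tail k c)) c"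
    show False
    proof (cases "reflection (c 0) (tail k c) = c")
      case False
      then have "lex_less c (reflection (c 0) (tail k c))" using nless lex_total by blast
      then obtain j where j: "\<forall>i<j. c i = reflection (c 0) (tail k c) i"
        "c j < reflection (c 0) (tail k c) j" by (rule lex_lessE)
      obtain b where b: "\<forall>i<Suc (k + j). b i = c i" "reflection_dominated b"
        using approx[of "Suc (k + j)"] by blast
      have bc: "b i = c i" if "i \<le> k + j" for i using b(1) that by simp
      have "lex_less b (reflection (b 0) (tail k b))"
      proof (rule lex_lessI[of j])
        show "b i = reflection (b 0) (tail k b) i" if "i < j" for i
          using spec[OF j(1), of i] that bc[of i] bc[of "k + i"] bc[of 0] by simp
        show "b j < reflection (b 0) (tail k b) j"
          using j(2) bc[of j] bc[of "k + j"] bc[of 0] by simp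
      qed
      then show False using reflection_dominatedD[OF b(2) k] lex_asym by blast
    next
      case True
      have eq: "c i = c 0 - c (k + i)" for i 
        using arg_cong[OF True, of "\<lambda>f. f i"] unfolding reflection_apply tail_apply by (rule sym)
      \<comment> \<open>Now \<open>c\<close> has period \<open>2 * k\<close>. A sequence \<open>b\<close> that first differs from \<open>c\<close> after the first
        period has too large a tail at \<open>2 * k\<close> if it exceeds \<open>c\<close> there, and too large a reflected
        tail at \<open>k\<close> otherwise.\<close>
      have per: "c (2 * k + i) = c i" for i
        using eq[of i] eq[of "k + i"] dig[of "2 * k + i"] by (simp add: mult_2 add.assoc)
      obtain b where b: "\<forall>i<2 * k. b i = c i" "\<forall>n. \<not> lex_less b (tail n b)" "reflection_dominated b"
        using approx[of "2 * k"] by blast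
      have b0: "b 0 = c 0" using b(1) k by simp
      have "b \<noteq> c" using reflection_dominatedD[OF b(3) k] nless by auto
      then obtain N where N: "\<forall>i<N. b i = c i" "b N \<noteq> c N" by (rule first_difference)
      have kN: "2 * k \<le> N" using N(2) b(1) not_less by blast
      then obtain t where t: "N = 2 * k + t" using le_Suc_ex by blast
      show False
      proof (cases "c N < b N")
        case True
        have "b i = tail (2 * k) b i" if "i < t" for i
          using that spec[OF N(1), of i] spec[OF N(1), of "2 * k + i"] per[of i] by (simp add: t)
        moreover have "b t < tail (2 * k) b t"
          using True spec[OF N(1), of t] per[of t] k by (simp add: t)
        ultimately have "lex_less b (tail (2 * k) b)" by (rule lex_lessI)
        then show False using b(2) by blast
      next
        case False
        then have less: "b N < c N" using N(2) by simp
        have "b i = reflection (b 0) (tail k b) i" if "i < k + t" for i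
          using that spec[OF N(1), of i] spec[OF N(1), of "k + i"] eq[of i] b0 k by (simp add: t)
        moreover have "b (k + t) < reflection (b 0) (tail k b) (k + t)"
        proof -
          have "b (k + t) = c 0 - c N"
            using spec[OF N(1), of "k + t"] eq[of "k + t"] k by (simp add: t mult_2 add.assoc)
          moreover have "c 0 - c N < c 0 - b N" using less dig[of N] by linarith
          ultimately show ?thesis using b0 by (simp add: t mult_2 add.assoc)
        qed
        ultimately have "lex_less b (reflection (b 0) (tail k b))" by (rule lex_lessI)
        then show False using reflection_dominatedD[OF b(3) k] lex_asym by blast
      qed
    qed
  qed
qed

lemma base_value_strict_antimono:
  assumes "1 < p" "p < q" "bounded_digits c" "c i > 0"
  shows "base_value q c < base_value p c"
proof -
  have q: "1 < q" using assms(1,2) by simp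
  note sp = summable_digits[OF assms(1,3)]
  note sq = summable_digits[OF q assms(3)]
  have less: "p ^ Suc n < q ^ Suc n" for n
    using assms(1,2) by (intro power_strict_mono) simp_all
  have pos: "0 < p ^ Suc n" for n
    using assms(1) by (intro zero_less_power) simp
  have le: "0 \<le> real (c n) / p ^ Suc n - real (c n) / q ^ Suc n" for n
    using frac_le[OF _ order_refl pos less_imp_le[OF less], of "real (c n)" n] by simp
  have "0 < real (c i) / p ^ Suc i - real (c i) / q ^ Suc i"
    using frac_less2[OF _ order_refl pos less, of "real (c i)" i] assms(4) by simp
  from suminf_pos2[OF summable_diff[OF sp sq] le this]
  show ?thesis
    unfolding base_value_def suminf_diff[OF sp sq, symmetric] by simp
qed

lemma isCont_base_value:
  assumes "1 < q" "bounded_digits c"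
  shows "isCont (\<lambda>q. base_value q c) q"
proof -
  define y where "y = (1 + q) / 2"
  have y: "1 < y" "y < q" using assms(1) by (auto simp: y_def)
  have "summable (\<lambda>n. real (c n) / y ^ Suc n * y)"
    by (intro summable_mult2 summable_digits assms y)
  also have "(\<lambda>n. real (c n) / y ^ Suc n * y) = (\<lambda>n. real (c n) * (1 / y) ^ n)"
    using y by (auto simp: power_divide field_simps)
  finally have "isCont (\<lambda>x. \<Sum>n. real (c n) * x ^ n) (1 / q)"
    by (rule isCont_powser) (use y in \<open>auto simp: field_simps\<close>)
  moreover have "isCont (\<lambda>p. 1 / p) q"
    using assms(1) by (intro continuous_intros) auto
  ultimately have "isCont (\<lambda>p. \<Sum>n. real (c n) * (1 / p) ^ n) q"
    by (rule isCont_o2[rotated])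
  then have "isCont (\<lambda>p. (\<Sum>n. real (c n) * (1 / p) ^ n) / p) q"
    by (rule isCont_divide) (use assms(1) in auto)
  moreover have "\<forall>\<^sub>F p in nhds q. (\<Sum>n. real (c n) * (1 / p) ^ n) / p = base_value p c"
  proof -
    have "\<forall>\<^sub>F p in nhds q. p \<in> {1<..}"
      by (rule eventually_nhds_in_open) (use assms in auto)
    then show ?thesis
    proof eventually_elim
      case (elim p)
      have "summable (\<lambda>n. real (c n) / p ^ Suc n * p)"
        by (intro summable_mult2 summable_digits assms) (use elim in auto)
      also have "(\<lambda>n. real (c n) / p ^ Suc n * p) = (\<lambda>n. real (c n) * (1 / p) ^ n)"
        using elim by (auto simp: power_divide field_simps)
      finally have s: "summable (\<lambda>n. real (c n) * (1 / p) ^ n)" .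
      show ?case
        unfolding base_value_def suminf_divide[OF s, symmetric]
        by (simp add: power_divide mult.commute)
    qed
  qed
  ultimately show ?thesis by (simp add: isCont_cong)
qed

lemma bounded_sequences_subsequence:
  fixes f :: "nat \<Rightarrow> nat \<Rightarrow> nat"
  assumes "\<And>n i. f n i \<le> B"
  shows "\<exists>r c. strict_mono (r :: nat \<Rightarrow> nat) \<and> (\<forall>i. \<forall>\<^sub>F n in sequentially. f (r n) i = c i)"
proof -
  have "compactin (product_topology (\<lambda>i::nat. euclidean) UNIV) (PiE UNIV (\<lambda>i. {..B}))"
    unfolding compactin_PiE by (simp add: finite_imp_compact)
  then have "compact (PiE UNIV (\<lambda>i::nat. {..B}))"
    by (simp add: euclidean_product_topology)
  then have "seq_compact (PiE UNIV (\<lambda>i::nat. {..B}))"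
    by (rule compact_imp_seq_compact)
  then obtain c and r :: "nat \<Rightarrow> nat" where r: "strict_mono r" "(f \<circ> r) \<longlonglongrightarrow> c"
    using seq_compactE[of _ f] assms by (metis (no_types, lifting) PiE_UNIV_domain Pi_I UNIV_I atMost_iff)
  have "\<forall>\<^sub>F n in sequentially. f (r n) i = c i" for i
  proof -
    have "(\<lambda>n. (f \<circ> r) n i) \<longlonglongrightarrow> c i"
      by (rule continuous_on_tendsto_compose[OF continuous_on_product_coordinates r(2)]) auto
    then have "\<forall>\<^sub>F n in sequentially. (f \<circ> r) n i \<in> {c i}"
      by (rule topological_tendstoD) (auto simp: open_discrete)
    then show ?thesis by simp
  qed
  then show ?thesis using r(1) by blast
qed

lemma base_value_limit:
  assumes "q > 1" "x \<longlonglongrightarrow> q" "\<And>n i. b n i \<le> B"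
    and ev: "\<And>i. \<forall>\<^sub>F n in sequentially. b n i = c i"
  shows "(\<lambda>n. base_value (x n) (b n)) \<longlonglongrightarrow> base_value q c"
proof -
  define y where "y = (1 + q) / 2"
  have y: "1 < y" "y < q" using assms(1) by (auto simp: y_def)
  have lim: "(\<lambda>n. real (b n k) / x n ^ Suc k) \<longlonglongrightarrow> real (c k) / q ^ Suc k" for k
  proof (intro tendsto_divide tendsto_power assms)
    show "(\<lambda>n. real (b n k)) \<longlonglongrightarrow> real (c k)"
      by (rule tendsto_eventually) (use ev[of k] in \<open>auto elim: eventually_mono\<close>)
  qed (use assms(1) in auto)
  have "\<forall>\<^sub>F n in sequentially. y < x n"
    by (rule order_tendstoD(1)[OF assms(2) y(2)])
  from eventually_prodI[OF eventually_True[of "at_top :: nat filter"] this]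
  have bound: "\<forall>\<^sub>F (k, n) in at_top \<times>\<^sub>F sequentially. norm (real (b n k) / x n ^ Suc k) \<le> real B / y ^ Suc k"
  proof (rule eventually_mono)
    fix kn :: "nat \<times> nat"
    assume "True \<and> y < x (snd kn)"
    moreover obtain k n where kn: "kn = (k, n)" by (cases kn) auto
    ultimately have less: "y < x n" by simp
    have "real (b n k) / x n ^ Suc k \<le> real B / y ^ Suc k"
      by (intro frac_le power_mono zero_less_power) (use less y assms(3) in \<open>auto\<close>)
    then show "case kn of (k, n) \<Rightarrow> norm (real (b n k) / x n ^ Suc k) \<le> real B / y ^ Suc k"
      using less y unfolding kn by simp
  qed
  show ?thesis
    unfolding base_value_def
    using tannerys_theorem[OF lim bound sums_summable[OF const_digits_sums[OF y(1)]]] by simp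
qed

lemma reflection_dominated_if_closure:
  assumes "q > 1" "quasi_greedy q a" "q \<in> closure univoque_bases"
  shows "reflection_dominated a"
proof -
  obtain x where x: "\<And>n. x n \<in> univoque_bases" "x \<longlonglongrightarrow> q"
    using assms(3) unfolding closure_sequential by blast
  have x1: "x n > 1" for n using x(1)[of n] by (simp add: univoque_bases_def)
  have "\<exists>b. \<forall>n. quasi_greedy (x n) (b n)"
    using quasi_greedy_exists[OF x1] by metis
  then obtain b where b: "\<And>n. quasi_greedy (x n) (b n)" by blast
  have "Bseq x" using x(2) by (meson convergentI convergent_imp_Bseq)
  then obtain K where K: "\<And>n. \<bar>x n\<bar> \<le> K" unfolding Bseq_def by auto
  have bB: "b n i \<le> nat \<lceil>K\<rceil>" for n i
  proof -
    have "real (b n i) < x n"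
      using quasi_greedy_digit_le[OF x1 b] max_digit_iff[OF x1] by blast
    then show ?thesis using K[of n] by linarith
  qed
  obtain r c where r: "strict_mono (r :: nat \<Rightarrow> nat)"
    and ev: "\<And>i. \<forall>\<^sub>F n in sequentially. b (r n) i = c i"
    using bounded_sequences_subsequence[of b, OF bB] by auto
  have approx: "\<exists>d. (\<forall>i<N. d i = c i) \<and> (\<forall>n. \<not> lex_less d (tail n d)) \<and> reflection_dominated d" for N
  proof -
    have "\<forall>\<^sub>F n in sequentially. \<forall>i\<in>{..<N}. b (r n) i = c i"
      by (rule eventually_ball_finite) (use ev in auto)
    from eventually_happens'[OF sequentially_bot this]
    obtain n where "\<forall>i<N. b (r n) i = c i" by auto
    then show ?thesis
      using quasi_greedy_tail_le[OF x1 b] reflection_dominated_if_univoque[OF x1 b x(1)] by blast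
  qed
  have "(\<lambda>n. x (r n)) \<longlonglongrightarrow> q" using LIMSEQ_subseq_LIMSEQ[OF x(2) r] by (simp add: o_def)
  then have "(\<lambda>n. base_value (x (r n)) (b (r n))) \<longlonglongrightarrow> base_value q c"
    by (rule base_value_limit[OF assms(1) _ bB ev])
  then have "base_value q c = 1"
    unfolding quasi_greedyD(2)[OF b] by (simp add: LIMSEQ_const_iff)
  \<comment> \<open>The limit has infinitely many nonzero digits and dominates its tails, whatever the side from
    which the bases approach.\<close>
  then have "quasi_greedy q c"
    by (rule quasi_greedyI[OF assms(1) _ limit_of_reflection_dominated(1,2)[OF approx]])
  then have "c = a" by (rule quasi_greedy_unique[OF assms(1) _ assms(2)])
  then show ?thesis using limit_of_reflection_dominated(3)[OF approx] by simp
qed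

lemma closure_if_reflection_dominated:
  assumes "q > 1" "quasi_greedy q a" "reflection_dominated a"
  shows "q \<in> closure univoque_bases"
  unfolding closure_approachable
proof (intro allI impI)
  fix e :: real assume e: "e > 0"
  define \<delta> where "\<delta> = min e (q - 1) / 2"
  have \<delta>: "0 < \<delta>" "\<delta> < e" "\<delta> < q - 1" using e assms(1) by (auto simp: \<delta>_def min_def)
  define p1 p2 where "p1 = q - \<delta>" and "p2 = q + \<delta>"
  have p: "1 < p1" "p1 < q" "q < p2" "1 < p2" using \<delta> by (auto simp: p1_def p2_def)
  note le = quasi_greedy_tail_le[OF assms(1,2)]
  note bd = quasi_greedyD(1)[OF assms(2)]
  have a0: "a 0 > 0"
    using quasi_greedy_first_digit[OF assms(1,2)] max_digit_bounds(1)[OF assms(1)] by simp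
  have big: "1 < base_value p1 a" and small: "base_value p2 a < 1"
    using base_value_strict_antimono[OF p(1,2) bd a0] base_value_strict_antimono[OF assms(1) p(3) bd a0]
      quasi_greedyD(2)[OF assms(2)] by simp_all
  have partial: "(\<lambda>m. \<Sum>i<m. real (a i) / p ^ Suc i) \<longlonglongrightarrow> base_value p a" if "1 < p" for p
    using summable_LIMSEQ[OF summable_digits[OF that bd]] unfolding base_value_def .
  \<comment> \<open>\<open>C\<close> bounds the value in base \<open>p2\<close> of any tail of the sequence \<open>v\<close> constructed below, which
    agrees with \<open>a\<close> on the first \<open>m\<close> digits. Hence for large \<open>m\<close> the base in which \<open>v\<close> represents 1
    lies between \<open>p1\<close> and \<open>p2\<close>.\<close>
  define C where "C = real (a 0) / (p2 - 1)"
  have "(\<lambda>m. (\<Sum>i<m. real (a i) / p2 ^ Suc i) + C * (1 / p2) ^ m) \<longlonglongrightarrow> base_value p2 a + C * 0"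
    by (intro tendsto_add tendsto_mult tendsto_const LIMSEQ_realpow_zero partial) (use p in auto)
  then have "\<forall>\<^sub>F m in sequentially. (\<Sum>i<m. real (a i) / p2 ^ Suc i) + C * (1 / p2) ^ m < 1"
    by (intro order_tendstoD(2)[where y = "base_value p2 a + C * 0"]) (use small in auto)
  moreover have "\<forall>\<^sub>F m in sequentially. 1 < (\<Sum>i<m. real (a i) / p1 ^ Suc i)"
    by (rule order_tendstoD(1)[OF partial[OF p(1)] big])
  ultimately have "\<forall>\<^sub>F m in sequentially. (\<Sum>i<m. real (a i) / p2 ^ Suc i) + C * (1 / p2) ^ m < 1 \<and>
      1 < (\<Sum>i<m. real (a i) / p1 ^ Suc i)"
    by (rule eventually_conj)
  then obtain N where N: "\<And>m. N \<le> m \<Longrightarrow> (\<Sum>i<m. real (a i) / p2 ^ Suc i) + C * (1 / p2) ^ m < 1 \<and>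
      1 < (\<Sum>i<m. real (a i) / p1 ^ Suc i)"
    unfolding eventually_sequentially by blast
  obtain m where m: "max 2 N \<le> m" "dominating_prefix m a"
    using dominating_prefix_unbounded[OF le assms(3)] by blast
  interpret dominating_word a m
    by unfold_locales (use m le in auto)
  have v_le: "v i \<le> v 0" for i
    unfolding v_0 using digit_le[of i] by (simp add: prefix_then_reflection_def)
  then have vbd: "bounded_digits v" by (auto intro: bounded_digitsI)
  have sum_v: "(\<Sum>i<m. real (v i) / p ^ Suc i) = (\<Sum>i<m. real (a i) / p ^ Suc i)" for p :: real
    by (intro sum.cong) (auto simp: v_prefix)
  have "base_value p2 (tail m v) \<le> C"
    unfolding C_def by (rule base_value_le) (use p v_le v_0 in auto)
  then have "base_value p2 (tail m v) / p2 ^ m \<le> C * (1 / p2) ^ m"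
    using p by (simp add: power_divide divide_right_mono)
  then have v_small: "base_value p2 v \<le> 1"
    using base_value_split[OF p(4) vbd, of m] N[of m] m(1) unfolding sum_v by simp
  have "0 \<le> base_value p1 (tail m v) / p1 ^ m"
    using base_value_nonneg[OF p(1) bounded_digits_tail[OF vbd]] p(1) by simp
  then have v_big: "1 \<le> base_value p1 v"
    using base_value_split[OF p(1) vbd, of m] N[of m] m(1) unfolding sum_v by simp
  have "continuous_on {p1..p2} (\<lambda>p. base_value p v)"
    by (intro continuous_at_imp_continuous_on ballI isCont_base_value vbd) (use p in auto)
  then obtain p where pp: "p1 \<le> p" "p \<le> p2" "base_value p v = 1"
    using IVT2'[of "\<lambda>p. base_value p v" p2 1 p1] v_small v_big p by auto
  have p1: "1 < p" using p pp by simp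
  have v_tails: "\<not> lex_less v (tail n v)" for n
  proof (cases n)
    case 0
    then show ?thesis using lex_irrefl by simp
  next
    case (Suc k)
    then show ?thesis using lex_asym[OF v_tail_below[of n]] by simp
  qed
  have "quasi_greedy p v"
    by (rule quasi_greedyI[OF p1 pp(3) v_tails reflection_dominated_infinite[OF v_le v_reflection_dominated]])
  then have "p \<in> univoque_bases"
    by (rule univoque_if_strictly_dominated[OF p1 _ v_tail_below v_reflection_dominated])
  moreover have "dist p q < e"
    using pp \<delta> by (auto simp: dist_real_def p1_def p2_def)
  ultimately show "\<exists>p\<in>univoque_bases. dist p q < e" by blast
qed

section \<open>Closed sets and subshifts\<close>

lemma openin_digit_topology_iff:
  "openin (digit_topology M) V \<longleftrightarrow> V \<subseteq> digit_seqs M \<and>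
     (\<forall>c\<in>V. \<exists>N. \<forall>d\<in>digit_seqs M. (\<forall>i<N. d i = c i) \<longrightarrow> d \<in> V)" (is "_ \<longleftrightarrow> ?R")
proof
  assume V: "openin (digit_topology M) V"
  then have "V \<subseteq> digit_seqs M" using openin_subset topspace_digit_topology by metis
  moreover have "\<exists>N. \<forall>d\<in>digit_seqs M. (\<forall>i<N. d i = c i) \<longrightarrow> d \<in> V" if c: "c \<in> V" for c
  proof -
    obtain U where U: "finite {i. U i \<noteq> {0..M}}" "c \<in> PiE UNIV U" "PiE UNIV U \<subseteq> V"
      using V c unfolding digit_topology_def openin_product_topology_alt by force
    obtain N where N: "\<And>i. U i \<noteq> {0..M} \<Longrightarrow> i < N"
      using U(1) unfolding finite_nat_set_iff_bounded by blast
    have "d \<in> V" if d: "d \<in> digit_seqs M" "\<forall>i<N. d i = c i" for d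
    proof -
      have "d i \<in> U i" for i
      proof (cases "U i = {0..M}")
        case True
        then show ?thesis using d(1) by (simp add: digit_seqs_def)
      next
        case False
        then show ?thesis using d(2) N U(2) by (auto simp: PiE_iff)
      qed
      then show ?thesis using U(3) by (auto simp: PiE_iff)
    qed
    then show ?thesis by blast
  qed
  ultimately show ?R by blast
next
  assume R: ?R
  show "openin (digit_topology M) V"
    unfolding openin_subopen[of _ V]
  proof
    fix c assume c: "c \<in> V"
    then obtain N where N: "\<forall>d\<in>digit_seqs M. (\<forall>i<N. d i = c i) \<longrightarrow> d \<in> V" using R by blast
    have cM: "c i \<le> M" for i using c R by (auto simp: digit_seqs_def)
    define T where "T = PiE (UNIV :: nat set) (\<lambda>i. if i < N then {c i} else {0..M})"
    have "openin (digit_topology M) T"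
      unfolding T_def digit_topology_def
    proof (rule product_topology_basis)
      show "finite {i. (if i < N then {c i} else {0..M}) \<noteq> topspace (discrete_topology {0..M})}"
        by (rule finite_subset[of _ "{..<N}"]) auto
    qed (use cM in auto)
    moreover have "c \<in> T" using cM by (auto simp: T_def)
    moreover have "T \<subseteq> V"
    proof
      fix d assume "d \<in> T"
      then have d: "d i \<in> (if i < N then {c i} else {0..M})" for i by (simp add: T_def PiE_iff)
      have "d i \<le> M" for i using d[of i] cM[of i] by (auto split: if_splits)
      moreover have "\<forall>i<N. d i = c i" using d by (metis singletonD)
      ultimately show "d \<in> V" using N by (auto simp: digit_seqs_def)
    qed
    ultimately show "\<exists>T. openin (digit_topology M) T \<and> c \<in> T \<and> T \<subseteq> V" by blast
  qed
qed

lemma closedin_digit_topology_iff: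
  "closedin (digit_topology M) S \<longleftrightarrow> S \<subseteq> digit_seqs M \<and>
     (\<forall>c\<in>digit_seqs M - S. \<exists>N. \<forall>d\<in>digit_seqs M. (\<forall>i<N. d i = c i) \<longrightarrow> d \<notin> S)"
  unfolding closedin_def topspace_digit_topology openin_digit_topology_iff
  by (simp cong: ball_cong conj_cong)

lemma subshift_imp_closedin:
  assumes "subshift M S"
  shows "closedin (digit_topology M) S"
proof -
  obtain F where S: "S \<subseteq> digit_seqs M"
    and F: "\<forall>c\<in>digit_seqs M. c \<in> S \<longleftrightarrow> (\<forall>i n. n \<ge> 1 \<longrightarrow> block c i n \<notin> F)"
    using assms by (auto simp: subshift_def forbidden_blocks_for_def)
  have "\<exists>N. \<forall>d\<in>digit_seqs M. (\<forall>i<N. d i = c i) \<longrightarrow> d \<notin> S" if c: "c \<in> digit_seqs M - S" for c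
  proof -
    obtain i n where n: "n \<ge> 1" "block c i n \<in> F" using c F by blast
    have "d \<notin> S" if d: "d \<in> digit_seqs M" "\<forall>j<i + n. d j = c j" for d
    proof -
      have "block d i n = block c i n" using d(2) by (simp add: block_def)
      then show ?thesis using d(1) F n by metis
    qed
    then show ?thesis by blast
  qed
  then show ?thesis using S unfolding closedin_digit_topology_iff by blast
qed

lemma not_closedin_if_reflection_dominated:
  assumes "q > 1" "quasi_greedy q a" "reflection_dominated a"
  shows "\<not> closedin (digit_topology (max_digit q)) (univoque_seqs q)"
proof
  assume cl: "closedin (digit_topology (max_digit q)) (univoque_seqs q)"
  note le = quasi_greedy_tail_le[OF assms(1,2)]
  note a0 = quasi_greedy_first_digit[OF assms(1,2)]
  note lex_iff = univoque_seqs_lex_iff[OF assms(1,2)]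
  have M: "0 < max_digit q" using max_digit_bounds(1)[OF assms(1)] by simp
  \<comment> \<open>The sequence \<open>0 a\<close> is not a unique expansion: \<open>1 0 0 \<dots>\<close> has the same value.\<close>
  define c where "c = (\<lambda>i. case i of 0 \<Rightarrow> 0 | Suc j \<Rightarrow> a j)"
  have tail_c: "tail (Suc 0) c = a" by (simp add: c_def tail_def)
  have "c i \<le> max_digit q" for i
    using quasi_greedy_digit_le[OF assms(1,2)] by (simp add: c_def split: nat.split)
  then have c_dig: "c \<in> digit_seqs (max_digit q)" by (simp add: digit_seqs_def)
  have "c 0 < max_digit q" using M by (simp add: c_def)
  then have "c \<notin> univoque_seqs q"
    using lex_irrefl[of a] lex_iff[of c] tail_c by metis
  then obtain N where N: "\<And>d. d \<in> digit_seqs (max_digit q) \<Longrightarrow> \<forall>i<N. d i = c i \<Longrightarrow> d \<notin> univoque_seqs q"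
    using cl c_dig unfolding closedin_digit_topology_iff by blast
  obtain m where m: "N + 2 \<le> m" "dominating_prefix m a"
    using dominating_prefix_unbounded[OF le assms(3)] by blast
  interpret dominating_word a m
    by unfold_locales (use m le in auto)
  define d where "d = (\<lambda>i. case i of 0 \<Rightarrow> 0 | Suc j \<Rightarrow> w j)"
  have tail_d: "tail (Suc n) d = tail n w" for n by (simp add: d_def tail_def)
  have d_le: "d i \<le> max_digit q" for i
    using w_le unfolding a0 by (simp add: d_def split: nat.split)
  have "d \<in> univoque_seqs q"
    unfolding lex_iff
  proof (intro conjI allI impI)
    show "lex_less (tail (Suc n) d) a" for n
      unfolding tail_d by (rule lex_below_imp_less[OF w_tail_below])
    show "lex_less (reflection (max_digit q) (tail (Suc n) d)) a" for n
      unfolding tail_d a0[symmetric] by (rule lex_below_imp_less[OF w_reflected_tail_below])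
  qed (rule d_le)
  moreover have "d i = c i" if "i < N" for i
    using that m(1) w_prefix by (auto simp: c_def d_def split: nat.split)
  moreover have "d \<in> digit_seqs (max_digit q)" using d_le by (simp add: digit_seqs_def)
  ultimately show False using N by blast
qed

lemma reflection_univoque_seqs:
  assumes "q > 1" "c \<in> univoque_seqs q"
  shows "reflection (max_digit q) c \<in> univoque_seqs q"
proof -
  obtain a where a: "quasi_greedy q a" using quasi_greedy_exists[OF assms(1)] by blast
  have c: "\<forall>i. c i \<le> max_digit q"
    "\<And>n. c n < max_digit q \<Longrightarrow> lex_less (tail (Suc n) c) a"
    "\<And>n. c n > 0 \<Longrightarrow> lex_less (reflection (max_digit q) (tail (Suc n) c)) a"
    using assms(2) unfolding univoque_seqs_lex_iff[OF assms(1) a] by blast+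
  have tl: "reflection (max_digit q) (reflection (max_digit q) (tail n c)) = tail n c" for n
    by (rule reflection_reflection) (use c(1) in simp)
  show ?thesis
    unfolding univoque_seqs_lex_iff[OF assms(1) a] tail_reflection tl
  proof (intro conjI allI impI)
    show "reflection (max_digit q) c i \<le> max_digit q" for i by simp
    show "lex_less (reflection (max_digit q) (tail (Suc n) c)) a"
      if "reflection (max_digit q) c n < max_digit q" for n
      by (rule c(3)) (use that in \<open>cases "c n", auto\<close>)
    show "lex_less (tail (Suc n) c) a" if "0 < reflection (max_digit q) c n" for n
      by (rule c(2)) (use that in simp)
  qed
qed

text \<open>
  A failure of \<open>reflection_dominated\<close> at $k$ turns the infinite lexicographic condition on unique
  expansions into one on blocks of length $k+1$.
\<close>

lemma tail_lex_below_if_not_dominated: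
  assumes "q > 1" "quasi_greedy q a" "k \<ge> 1" "\<not> lex_less (reflection (a 0) (tail k a)) a"
    and c: "c \<in> univoque_seqs q" and "c n < max_digit q"
  shows "lex_below k (tail (Suc n) c) a"
proof -
  note lex_iff = univoque_seqs_lex_iff[OF assms(1,2)]
  note a0 = quasi_greedy_first_digit[OF assms(1,2)]
  have "lex_less (tail (Suc n) c) a" using c assms(6) unfolding lex_iff by blast
  then obtain j where j: "\<forall>i<j. tail (Suc n) c i = a i" "tail (Suc n) c j < a j" by (rule lex_lessE)
  have "j < k"
  proof (rule ccontr)
    assume "\<not> j < k"
    then obtain t where t: "j = k + t" using le_Suc_ex by (metis not_less)
    have "tail (Suc n) c 0 = a 0" using j(1) assms(3) t by auto
    then have "c (Suc n) > 0" using a0 max_digit_bounds(1)[OF assms(1)] by simp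
    then have ex: "\<exists>i\<le>n + k. c i > 0" using assms(3) by (intro exI[of _ "Suc n"]) auto
    have "lex_less (reflection (a 0) (tail (Suc (n + k)) c)) a"
      by (rule reflection_less_after_positive_digit[OF quasi_greedy_tail_le[OF assms(1,2)] _ ex])
         (use c in \<open>unfold lex_iff a0, blast\<close>)
    moreover have "lex_less (tail (Suc (n + k)) c) (tail k a)"
    proof (rule lex_lessI[of t])
      show "tail (Suc (n + k)) c i = tail k a i" if "i < t" for i
        using spec[OF j(1), of "k + i"] that by (simp add: t add.assoc)
      show "tail (Suc (n + k)) c t < tail k a t"
        using j(2) by (simp add: t add.assoc)
    qed
    then have "lex_less (reflection (a 0) (tail k a)) (reflection (a 0) (tail (Suc (n + k)) c))"
      by (rule lex_less_reflection)
         (use c quasi_greedy_digit_le[OF assms(1,2)] in \<open>auto simp: lex_iff a0\<close>)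
    ultimately show False using assms(4) lex_trans by blast
  qed
  then show ?thesis using j by (auto intro: lex_belowI)
qed

lemma subshift_finite_type_if_not_dominated:
  assumes "q > 1" "quasi_greedy q a" "\<not> reflection_dominated a"
  shows "subshift_finite_type (max_digit q) (univoque_seqs q)"
proof -
  define M where "M = max_digit q"
  note lex_iff = univoque_seqs_lex_iff[OF assms(1,2), folded M_def]
  obtain k where k: "k \<ge> 1" "\<not> lex_less (reflection (a 0) (tail k a)) a"
    using assms(3) by (auto simp: reflection_dominated_def)
  have local_iff: "c \<in> univoque_seqs q \<longleftrightarrow> (\<forall>i. c i \<le> M) \<and>
      (\<forall>n. (c n < M \<longrightarrow> lex_below k (tail (Suc n) c) a) \<and>
           (c n > 0 \<longrightarrow> lex_below k (reflection M (tail (Suc n) c)) a))" (is "_ \<longleftrightarrow> ?R") for c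
  proof
    assume c: "c \<in> univoque_seqs q"
    have c_le: "\<forall>i. c i \<le> M" using c unfolding lex_iff by blast
    have "lex_below k (reflection M (tail (Suc n) c)) a" if "c n > 0" for n
    proof -
      have "reflection M c n < M" using that c_le[rule_format, of n] by simp
      from tail_lex_below_if_not_dominated[OF assms(1,2) k reflection_univoque_seqs[OF assms(1) c], folded M_def, OF this]
      show ?thesis unfolding tail_reflection .
    qed
    then show ?R
      using c_le tail_lex_below_if_not_dominated[OF assms(1,2) k c, folded M_def] by blast
  next
    assume ?R
    then show "c \<in> univoque_seqs q" unfolding lex_iff using lex_below_imp_less by blast
  qed
  define ok where "ok x \<longleftrightarrow> (x ! 0 < M \<longrightarrow> lex_below k (\<lambda>i. x ! Suc i) a) \<and>
      (x ! 0 > 0 \<longrightarrow> lex_below k (\<lambda>i. M - x ! Suc i) a)" for x :: "nat list"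
  define F where "F = {x. set x \<subseteq> {0..M} \<and> length x = Suc k \<and> \<not> ok x}"
  have block_nth: "block c n (Suc k) ! i = c (n + i)" if "i < Suc k" for c n i
    using that unfolding block_def by (simp add: nth_append del: upt_Suc)
  have ok_block: "ok (block c n (Suc k)) \<longleftrightarrow> (c n < M \<longrightarrow> lex_below k (tail (Suc n) c) a) \<and>
           (c n > 0 \<longrightarrow> lex_below k (reflection M (tail (Suc n) c)) a)" for c n
  proof -
    have "lex_below k (\<lambda>i. block c n (Suc k) ! Suc i) a \<longleftrightarrow> lex_below k (tail (Suc n) c) a"
      by (intro iffI; erule lex_below_cong) (simp_all add: block_nth)
    moreover have "lex_below k (\<lambda>i. M - block c n (Suc k) ! Suc i) a \<longleftrightarrow>
        lex_below k (reflection M (tail (Suc n) c)) a"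
      by (intro iffI; erule lex_below_cong) (simp_all add: block_nth)
    ultimately show ?thesis unfolding ok_def using block_nth[of 0 c n] by simp
  qed
  have "finite F"
    by (rule finite_subset[OF _ finite_lists_length_eq[of "{0..M}" "Suc k"]]) (auto simp: F_def)
  moreover have "forbidden_blocks_for M (univoque_seqs q) F"
    unfolding forbidden_blocks_for_def
  proof (intro conjI ballI)
    show "F \<subseteq> digit_blocks M" by (auto simp: F_def digit_blocks_def)
    fix c assume c: "c \<in> digit_seqs M"
    have in_F: "block c i n \<in> F \<longleftrightarrow> n = Suc k \<and> \<not> ok (block c i (Suc k))" for i n
      using c by (auto simp: F_def block_def digit_seqs_def simp del: upt_Suc)
    have "c \<in> univoque_seqs q \<longleftrightarrow> (\<forall>n. ok (block c n (Suc k)))"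
      unfolding local_iff ok_block using c by (auto simp: digit_seqs_def)
    then show "c \<in> univoque_seqs q \<longleftrightarrow> (\<forall>i n. n \<ge> 1 \<longrightarrow> block c i n \<notin> F)"
      unfolding in_F by auto
  qed
  moreover have "univoque_seqs q \<subseteq> digit_seqs M"
    using lex_iff by (auto simp: digit_seqs_def)
  ultimately show ?thesis by (auto simp: subshift_finite_type_def M_def)
qed

theorem theorem1p8:
  fixes q :: real
  assumes "q > 1"
  shows "(q \<in> {1<..} - closure univoque_bases
            \<longleftrightarrow> subshift_finite_type (max_digit q) (univoque_seqs q)) \<and>
         (subshift_finite_type (max_digit q) (univoque_seqs q)
            \<longleftrightarrow> subshift (max_digit q) (univoque_seqs q)) \<and>
         (subshift (max_digit q) (univoque_seqs q)
            \<longleftrightarrow> closedin (digit_topology (max_digit q)) (univoque_seqs q))"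
proof -
  obtain a where a: "quasi_greedy q a" using quasi_greedy_exists[OF assms] by blast
  have "q \<in> closure univoque_bases \<longleftrightarrow> reflection_dominated a"
    using reflection_dominated_if_closure[OF assms a] closure_if_reflection_dominated[OF assms a] by blast
  moreover have "subshift_finite_type (max_digit q) (univoque_seqs q)" if "\<not> reflection_dominated a"
    by (rule subshift_finite_type_if_not_dominated[OF assms a that])
  moreover have "subshift (max_digit q) (univoque_seqs q)"
    if "subshift_finite_type (max_digit q) (univoque_seqs q)"
    using that by (auto simp: subshift_finite_type_def subshift_def)
  moreover have "closedin (digit_topology (max_digit q)) (univoque_seqs q)"
    if "subshift (max_digit q) (univoque_seqs q)"
    using that by (rule subshift_imp_closedin)
  moreover have "\<not> reflection_dominated a"
    if "closedin (digit_topology (max_digit q)) (univoque_seqs q)"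
    using that not_closedin_if_reflection_dominated[OF assms a] by blast
  ultimately show ?thesis using assms by auto
qed

end
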